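(* Let $X$ be a Cahen-Wallach space and let $\Gamma\subset G$ be a discrete subgroup acting freely and properly on $X$. The holonomy group of the quotient $Y=\Gamma\backslash X$ is isomorphic to $\hat G_+\rtimes p_K(\Gamma)$, where $p_K:G=\hat G\rtimes K\to K$ denotes the projection to $K$. In particular, it is connected if and only if it is abelian, and this holds if and only if $\Gamma$ is contained in the group of transvections $\hat G$ of $X$.
   Context: For integers $p,q\ge0$ with $n:=p+q\ge1$, $\lambda\in(\mathbb R^* )^p$, $\mu\in(\mathbb R^* )^q$ ($\mathbb R^*=\mathbb R\setminus\{0\}$), let $X_{p,q}(\lambda;\mu)$ be $\mathbb R^{n+2}$ with coordinates $(z,z',x_1,\dots,x_n)$ and Lorentzian metric $2\,dz\,dz'+\sum_{i=1}^{n}dx_i^2+\big(\sum_{i=1}^p\lambda_i^2x_i^2-\sum_{j=1}^q\mu_j^2x_{p+j}^2\big)dz'^2$. A Cahen-Wallach space is a Lorentzian manifold isometric to some $X_{p,q}(\lambda;\mu)$. Let $X=X_{p,q}(\lambda;\mu)$. Let $\mathfrak a=\mathbb C^p\oplus\mathbb C^q$ (as a real vector space), $\theta_{\mathfrak a}$ coordinatewise complex conjugation, $\mathfrak a_+=\mathbb R^n\subset\mathfrak a$, $L(u,w)=(i\lambda_1\bar u_1,\dots,i\lambda_p\bar u_p,i\mu_1w_1,\dots,i\mu_qw_q)$, $\langle(u,w),(u',w')\rangle_{\mathfrak a}=-\mathrm{Re}(u^\top u')+\mathrm{Re}(w^\top\overline{w'})$, $\omega=\langle L\,\cdot,\cdot\rangle_{\mathfrak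 a}$. Let $H=\mathfrak z\times\mathfrak a$, $\mathfrak z=\mathbb R$, be the Heisenberg group with $(z,a)(z',a')=(z+z'+\frac12\omega(a,a'),a+a')$, and $\hat G=H\rtimes\mathbb R$, where $t\in\mathbb R$ acts by $(z,a)\mapsto(z,e^{tL}a)$. $\hat G$ is the transvection group of $X$, and $\hat G_+:=\mathfrak a_+\subset\hat G$ is the stabiliser in $\hat G$ of a base point, $X=\hat G/\hat G_+$. Let $K=\{\varphi\in O(\mathfrak a,\langle\cdot,\cdot\rangle_{\mathfrak a})\mid\theta_{\mathfrak a}\varphi=\varphi\theta_{\mathfrak a},\ L\varphi=\varphi L\}$, acting on $\hat G$ via its action on $\mathfrak a$ (hence on $\hat G_+=\mathfrak a_+$). Then $G:=\hat G\rtimes K$ is a subgroup of index $2$ of $\mathrm{Iso}(X)$ and $X=G/(\hat G_+\rtimes K)$. *)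

theory Defs
  imports "HOL-Analysis.Analysis" "HOL-Algebra.Coset"
begin

section \<open>Holonomy of pseudo-Riemannian manifolds given by local parametrizations\<close>

text \<open>
  A pseudo-Riemannian manifold with points of type \<open>'m\<close>, modelled on the Euclidean space \<open>'e\<close>,
  is given by a set of local parametrizations: injective maps from open subsets of \<open>'e\<close> to \<open>'m\<close>
  (inverses of charts), each carrying the coefficients of the metric in that chart.
\<close>

record ('e, 'm) chart =
  dom :: "'e set"
  par :: "'e \<Rightarrow> 'm"
  met :: "'e \<Rightarrow> 'e \<Rightarrow> 'e \<Rightarrow> real"

text \<open>The Christoffel symbols of the second kind, as a bilinear map in \<open>u\<close> and \<open>v\<close>, determined by
  $2 g(\Gamma(u,v),w) = \partial_u g(v,w) + \partial_v g(u,w) - \partial_w g(u,v)$.\<close>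

definition christoffel :: "('e::euclidean_space \<Rightarrow> 'e \<Rightarrow> 'e \<Rightarrow> real) \<Rightarrow> 'e \<Rightarrow> 'e \<Rightarrow> 'e \<Rightarrow> 'e" where
  "christoffel g x u v = (THE y. \<forall>w. g x y w = 1/2 *
     ( frechet_derivative (\<lambda>p. g p v w) (at x) u
     + frechet_derivative (\<lambda>p. g p u w) (at x) v
     - frechet_derivative (\<lambda>p. g p u v) (at x) w))"

definition C1_curve_on :: "real set \<Rightarrow> (real \<Rightarrow> 'e::euclidean_space) \<Rightarrow> (real \<Rightarrow> 'e) \<Rightarrow> bool" where
  "C1_curve_on I x x' \<longleftrightarrow>
     (\<forall>r\<in>I. (x has_vector_derivative x' r) (at r within I)) \<and> continuous_on I x'"

definition parallel_on :: "('e::euclidean_space \<Rightarrow> 'e \<Rightarrow> 'e \<Rightarrow> real) \<Rightarrow> real set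
    \<Rightarrow> (real \<Rightarrow> 'e) \<Rightarrow> (real \<Rightarrow> 'e) \<Rightarrow> (real \<Rightarrow> 'e) \<Rightarrow> bool" where
  "parallel_on g I x x' V \<longleftrightarrow>
     (\<forall>r\<in>I. (V has_vector_derivative - christoffel g (x r) (x' r) (V r)) (at r within I))"

text \<open>
  \<open>par_transport M c (\<kappa>, s) (\<kappa>', t) T\<close>: the restriction of the curve \<open>c\<close> to \<open>[s,t]\<close> is piecewise
  \<open>C\<^sup>1\<close>, and \<open>T\<close> is the Levi-Civita parallel transport along it from the tangent space at \<open>c s\<close> to
  the one at \<open>c t\<close>, these being identified with \<open>'e\<close> by the charts \<open>\<kappa>\<close> and \<open>\<kappa>'\<close>.
  The three rules are: a \<open>C\<^sup>1\<close> piece inside one chart; the change of the chart at a fixed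
  time, where the differential of the transition map appears; concatenation.
\<close>

inductive par_transport :: "('e::euclidean_space, 'm) chart set \<Rightarrow> (real \<Rightarrow> 'm)
    \<Rightarrow> ('e, 'm) chart \<times> real \<Rightarrow> ('e, 'm) chart \<times> real \<Rightarrow> ('e \<Rightarrow>\<^sub>L 'e) \<Rightarrow> bool"
  for M c where
  piece: "par_transport M c (\<kappa>, s) (\<kappa>, t) T"
    if "\<kappa> \<in> M" and "s \<le> t"
      and "\<forall>r\<in>{s..t}. x r \<in> dom \<kappa> \<and> par \<kappa> (x r) = c r"
      and "C1_curve_on {s..t} x x'"
      and "\<forall>v. \<exists>V. parallel_on (met \<kappa>) {s..t} x x' V \<and> V s = v \<and> V t = blinfun_apply T v"
| change: "par_transport M c (\<kappa>, t) (\<kappa>', t) T"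
    if "\<kappa> \<in> M" and "\<kappa>' \<in> M"
      and "u \<in> dom \<kappa>" and "par \<kappa> u = c t" and "c t \<in> par \<kappa>' ` dom \<kappa>'"
      and "((inv_into (dom \<kappa>') (par \<kappa>') \<circ> par \<kappa>) has_derivative blinfun_apply T) (at u)"
| concat: "par_transport M c a d (T' o\<^sub>L T)"
    if "par_transport M c a b T" and "par_transport M c b d T'"

text \<open>The holonomy group at the point \<open>y\<close>, as a group of linear automorphisms of the tangent space
  at \<open>y\<close>, which is identified with \<open>'e\<close> by a chart \<open>\<kappa>\<close> around \<open>y\<close>.\<close>

definition holonomy_group :: "('e::euclidean_space, 'm) chart set \<Rightarrow> ('e, 'm) chart \<Rightarrow> 'm
    \<Rightarrow> ('e \<Rightarrow>\<^sub>L 'e) monoid" where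
  "holonomy_group M \<kappa> y =
     \<lparr>carrier = {T. \<exists>c. c 0 = y \<and> c 1 = y \<and> par_transport M c (\<kappa>, 0) (\<kappa>, 1) T},
      mult = (o\<^sub>L), one = id_blinfun\<rparr>"

text \<open>The quotient of \<open>('e, g)\<close> by a group of isometries, with orbit map \<open>\<pi>\<close>. Its smooth
  structure and metric are those for which \<open>\<pi>\<close> is a local isometry, so its charts are the local
  inverses of \<open>\<pi>\<close>.\<close>

definition quotient_manifold :: "('e::euclidean_space \<Rightarrow> 'e \<Rightarrow> 'e \<Rightarrow> real) \<Rightarrow> ('e \<Rightarrow> 'm)
    \<Rightarrow> ('e, 'm) chart set" where
  "quotient_manifold g \<pi> = {\<lparr>dom = U, par = \<pi>, met = g\<rparr> |U. open U \<and> inj_on \<pi> U}"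


section \<open>Semidirect products\<close>

definition semidirect :: "('a, 'c) monoid_scheme \<Rightarrow> ('b, 'd) monoid_scheme \<Rightarrow> ('b \<Rightarrow> 'a \<Rightarrow> 'a)
    \<Rightarrow> ('a \<times> 'b) monoid" where
  "semidirect N Q \<alpha> =
     \<lparr>carrier = carrier N \<times> carrier Q,
      mult = (\<lambda>(n, h) (n', h'). (n \<otimes>\<^bsub>N\<^esub> \<alpha> h n', h \<otimes>\<^bsub>Q\<^esub> h')),
      one = (\<one>\<^bsub>N\<^esub>, \<one>\<^bsub>Q\<^esub>)\<rparr>"


section \<open>Cahen-Wallach spaces\<close>

text \<open>
  The \<open>n\<close> coordinates \<open>x\<^sub>i\<close> are indexed by the finite type \<open>'n\<close>. The set \<open>P\<close> consists of the \<open>p\<close>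
  indices belonging to \<open>\<lambda>\<close>, its complement of the \<open>q\<close> indices belonging to \<open>\<mu>\<close> (both may be empty),
  and the single vector \<open>\<nu>\<close> comprises \<open>\<lambda>\<close> (on \<open>P\<close>) and \<open>\<mu>\<close> (on \<open>-P\<close>).
  The points are the triples \<open>(z, z', x)\<close>.
\<close>

type_synonym 'n cw_point = "real \<times> real \<times> (real^'n)"

definition cw_metric :: "'n::finite set \<Rightarrow> real^'n \<Rightarrow> 'n cw_point \<Rightarrow> 'n cw_point \<Rightarrow> 'n cw_point \<Rightarrow> real"
  where "cw_metric P \<nu> = (\<lambda>(z, z', x) (v, v', \<xi>) (w, w', \<eta>).
     v * w' + v' * w + (\<Sum>i\<in>UNIV. \<xi> $ i * \<eta> $ i)
     + ((\<Sum>i\<in>P. (\<nu> $ i)\<^sup>2 * (x $ i)\<^sup>2) - (\<Sum>j\<in>-P. (\<nu> $ j)\<^sup>2 * (x $ j)\<^sup>2)) * (v' * w'))"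

definition cw_theta :: "complex^'n \<Rightarrow> complex^'n" where
  "cw_theta a = (\<chi> i. cnj (a $ i))"

definition cw_aplus :: "(complex^'n) set" where
  "cw_aplus = {a. \<forall>i. a $ i \<in> \<real>}"

definition cw_L :: "'n::finite set \<Rightarrow> real^'n \<Rightarrow> complex^'n \<Rightarrow> complex^'n" where
  "cw_L P \<nu> a = (\<chi> i. if i \<in> P then \<i> * of_real (\<nu> $ i) * cnj (a $ i) else \<i> * of_real (\<nu> $ i) * a $ i)"

definition cw_ip :: "'n::finite set \<Rightarrow> complex^'n \<Rightarrow> complex^'n \<Rightarrow> real" where
  "cw_ip P a b = - Re (\<Sum>i\<in>P. a $ i * b $ i) + Re (\<Sum>j\<in>-P. a $ j * cnj (b $ j))"

definition cw_omega :: "'n::finite set \<Rightarrow> real^'n \<Rightarrow> complex^'n \<Rightarrow> complex^'n \<Rightarrow> real" where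
  "cw_omega P \<nu> a b = cw_ip P (cw_L P \<nu> a) b"

text \<open>The exponential \<open>e\<^sup>t\<^sup>L\<close>.\<close>

definition cw_expL :: "'n::finite set \<Rightarrow> real^'n \<Rightarrow> real \<Rightarrow> complex^'n \<Rightarrow> complex^'n" where
  "cw_expL P \<nu> t a = (\<Sum>k. (t ^ k / fact k) *\<^sub>R (cw_L P \<nu> ^^ k) a)"

definition cw_heisenberg :: "'n::finite set \<Rightarrow> real^'n \<Rightarrow> (real \<times> (complex^'n)) monoid" where
  "cw_heisenberg P \<nu> =
     \<lparr>carrier = UNIV,
      mult = (\<lambda>(z, a) (z', a'). (z + z' + 1/2 * cw_omega P \<nu> a a', a + a')),
      one = (0, 0)\<rparr>"

type_synonym 'n cw_transvection = "(real \<times> (complex^'n)) \<times> real"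

definition cw_Ghat :: "'n::finite set \<Rightarrow> real^'n \<Rightarrow> 'n cw_transvection monoid" where
  "cw_Ghat P \<nu> = semidirect (cw_heisenberg P \<nu>) \<lparr>carrier = UNIV, mult = (+), one = (0::real)\<rparr>
     (\<lambda>t (z, a). (z, cw_expL P \<nu> t a))"

definition cw_Ghat_plus :: "'n::finite set \<Rightarrow> real^'n \<Rightarrow> 'n cw_transvection monoid" where
  "cw_Ghat_plus P \<nu> = (cw_Ghat P \<nu>)\<lparr>carrier := {((0, a), 0) |a. a \<in> cw_aplus}\<rparr>"

text \<open>The isometries in \<open>K\<close> are real linear.\<close>

type_synonym 'n cw_end = "(complex^'n) \<Rightarrow>\<^sub>L (complex^'n)"

definition cw_K :: "'n::finite set \<Rightarrow> real^'n \<Rightarrow> 'n cw_end monoid" where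
  "cw_K P \<nu> =
     \<lparr>carrier = {\<phi>. bij (blinfun_apply \<phi>) \<and> (\<forall>a b. cw_ip P (\<phi> a) (\<phi> b) = cw_ip P a b)
        \<and> (\<forall>a. cw_theta (\<phi> a) = \<phi> (cw_theta a)) \<and> (\<forall>a. cw_L P \<nu> (\<phi> a) = \<phi> (cw_L P \<nu> a))},
      mult = (o\<^sub>L), one = id_blinfun\<rparr>"

definition cw_K_act :: "'n::finite cw_end \<Rightarrow> 'n cw_transvection \<Rightarrow> 'n cw_transvection" where
  "cw_K_act \<phi> = (\<lambda>((z, a), t). ((z, \<phi> a), t))"

definition cw_G :: "'n::finite set \<Rightarrow> real^'n \<Rightarrow> ('n cw_transvection \<times> 'n cw_end) monoid" where
  "cw_G P \<nu> = semidirect (cw_Ghat P \<nu>) (cw_K P \<nu>) cw_K_act"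

text \<open>The transvection group \<open>Ghat\<close> as a subgroup of \<open>G\<close>, and the stabiliser of the base point.\<close>

definition cw_Ghat_in_G :: "'n::finite set \<Rightarrow> real^'n \<Rightarrow> ('n cw_transvection \<times> 'n cw_end) set" where
  "cw_Ghat_in_G P \<nu> = {(g, id_blinfun) |g. g \<in> carrier (cw_Ghat P \<nu>)}"

definition cw_stabiliser :: "'n::finite set \<Rightarrow> real^'n \<Rightarrow> ('n cw_transvection \<times> 'n cw_end) set" where
  "cw_stabiliser P \<nu> = carrier (semidirect (cw_Ghat_plus P \<nu>) (cw_K P \<nu>) cw_K_act)"

text \<open>
  The identification of the coordinate space with the homogeneous space
  \<open>Ghat / Ghat\<^sub>+ = G / (Ghat\<^sub>+ \<rtimes> K)\<close>: the point \<open>(z, z', x)\<close> is the coset of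
  \<open>exp(z' l) \<cdot> (z, \<i> x)\<close>, where \<open>exp(z' l)\<close> is the element \<open>z'\<close> of the factor \<open>\<real>\<close> of \<open>Ghat\<close>.
  In the Maurer-Cartan form of this section, the part complementary to the Lie algebra
  \<open>\<aa>\<^sub>+\<close> of \<open>Ghat\<^sub>+\<close> is
  \<open>dz' l + (dz - 1/2 \<langle>L(\<i> x), L(\<i> x)\<rangle> dz') + \<i> dx\<close>. Hence the invariant metric on the homogeneous
  space for which \<open>\<zz>\<close> and \<open>l\<close> are null, paired to 1 and orthogonal to \<open>\<i> \<real>\<^sup>n \<subseteq> \<aa>\<close>, is
  exactly \<open>cw_metric\<close> in these coordinates.
\<close>

definition cw_section :: "'n::finite set \<Rightarrow> real^'n \<Rightarrow> 'n cw_point \<Rightarrow> 'n cw_transvection \<times> 'n cw_end" where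
  "cw_section P \<nu> = (\<lambda>(z, z', x).
     (((0, 0), z') \<otimes>\<^bsub>cw_Ghat P \<nu>\<^esub> ((z, \<chi> i. \<i> * of_real (x $ i)), 0), id_blinfun))"

text \<open>The action of \<open>G\<close> on \<open>X\<close> by left translation of cosets.\<close>

definition cw_act :: "'n::finite set \<Rightarrow> real^'n \<Rightarrow> 'n cw_transvection \<times> 'n cw_end
    \<Rightarrow> 'n cw_point \<Rightarrow> 'n cw_point" where
  "cw_act P \<nu> g x = (THE y. g \<otimes>\<^bsub>cw_G P \<nu>\<^esub> cw_section P \<nu> x
      \<in> cw_section P \<nu> y <#\<^bsub>cw_G P \<nu>\<^esub> cw_stabiliser P \<nu>)"

definition cw_orbit :: "'n::finite set \<Rightarrow> real^'n \<Rightarrow> ('n cw_transvection \<times> 'n cw_end) set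
    \<Rightarrow> 'n cw_point \<Rightarrow> 'n cw_point set" where
  "cw_orbit P \<nu> \<Gamma> x = (\<lambda>\<gamma>. cw_act P \<nu> \<gamma> x) ` \<Gamma>"

definition cw_acts_freely :: "'n::finite set \<Rightarrow> real^'n \<Rightarrow> ('n cw_transvection \<times> 'n cw_end) set \<Rightarrow> bool" where
  "cw_acts_freely P \<nu> \<Gamma> \<longleftrightarrow> (\<forall>\<gamma>\<in>\<Gamma>. \<forall>x. cw_act P \<nu> \<gamma> x = x \<longrightarrow> \<gamma> = \<one>\<^bsub>cw_G P \<nu>\<^esub>)"

definition cw_acts_properly :: "'n::finite set \<Rightarrow> real^'n \<Rightarrow> ('n cw_transvection \<times> 'n cw_end) set \<Rightarrow> bool" where
  "cw_acts_properly P \<nu> \<Gamma> \<longleftrightarrow>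
     proper_map (prod_topology (top_of_set \<Gamma>) euclidean) (prod_topology euclidean euclidean)
       (\<lambda>(\<gamma>, x). (cw_act P \<nu> \<gamma> x, x))"

text \<open>The quotient \<open>Y = \<Gamma>\<setminus>X\<close>; its points are the orbits.\<close>

definition cw_quotient :: "'n::finite set \<Rightarrow> real^'n \<Rightarrow> ('n cw_transvection \<times> 'n cw_end) set
    \<Rightarrow> ('n cw_point, 'n cw_point set) chart set" where
  "cw_quotient P \<nu> \<Gamma> = quotient_manifold (cw_metric P \<nu>) (cw_orbit P \<nu> \<Gamma>)"

text \<open>\<open>Ghat\<^sub>+ \<rtimes> p\<^sub>K(\<Gamma>)\<close>, where \<open>p\<^sub>K\<close> is \<open>snd\<close>.\<close>

definition cw_Ghat_plus_pK :: "'n::finite set \<Rightarrow> real^'n \<Rightarrow> ('n cw_transvection \<times> 'n cw_end) set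
    \<Rightarrow> ('n cw_transvection \<times> 'n cw_end) monoid" where
  "cw_Ghat_plus_pK P \<nu> \<Gamma> =
     semidirect (cw_Ghat_plus P \<nu>) ((cw_K P \<nu>)\<lparr>carrier := snd ` \<Gamma>\<rparr>) cw_K_act"

end

theory Submission
  imports Defs
begin

text \<open>
  In the global chart the Levi-Civita transport is computed explicitly: along a curve
  \<open>(x\<^sub>0, x\<^sub>1, x)\<close> from \<open>p\<close> to \<open>p'\<close> it depends only on the endpoints and on the vector
  \<open>w = \<integral> \<sigma> x dx\<^sub>1\<close> with \<open>\<sigma>\<^sub>i = \<plusminus> \<nu>\<^sub>i\<^sup>2\<close>, through a null rotation by \<open>w\<close>. The differential of an
  element of \<open>G\<close> is such a null rotation composed with the orthogonal map \<open>A\<close> which its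
  \<open>K\<close>-component induces on the imaginary part of \<open>\<aa>\<close>. Loops in the quotient lift to curves from
  \<open>u\<close> to \<open>\<gamma> u\<close>, so each holonomy is a pair \<open>(w, A)\<close>; conversely \<open>w\<close> can be prescribed for any
  endpoints, because all \<open>\<nu>\<^sub>i\<close> are nonzero. The map \<open>(w, A) \<mapsto> (\<nu>\<^sup>-\<^sup>1 w, \<phi>)\<close> is the isomorphism.
  Finally \<open>\<Gamma>\<close> is countable, so its image in \<open>K\<close> is connected only if it is trivial.
\<close>

subsection \<open>Coordinates on the transvection group\<close>

text \<open>The definition of holonomy offers only a relation generated by three rules inside
  charts, and its curves carry no lift. The upper bound therefore tracks lifts chart by chart: every
  chart is a local inverse of the orbit map, so a point of the quotient has at most one lift in its
  domain, and a change of chart replaces this lift by its image under an element of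
  \<open>\<Gamma>\<close>. The lower bound needs a chart around every point and a compactness
  argument along a chosen curve. Three facts keep the computation closed. The parallel equation is
  triangular in \<open>(v\<^sub>1, v, v\<^sub>0)\<close>, so integration solves it. The elements of
  \<open>K\<close> commute with \<open>L\<close>, hence their orthogonal part commutes with
  \<sigma>, which puts the differentials of group elements into the same family as the transports.
  The scalar that depends on the points is a difference of values of \<open>q\<close>, so it
  telescopes and vanishes for a loop. Discreteness, freeness and properness enter through two
  consequences: charts exist around every point, and \<open>\<Gamma>\<close> is countable.\<close>

definition cvec :: "real^'n \<Rightarrow> real^'n \<Rightarrow> complex^'n" where
  "cvec b c = (\<chi> i. Complex (b $ i) (c $ i))"

definition vRe :: "complex^'n \<Rightarrow> real^'n" where
  "vRe a = (\<chi> i. Re (a $ i))"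

definition vIm :: "complex^'n \<Rightarrow> real^'n" where
  "vIm a = (\<chi> i. Im (a $ i))"

definition cw_eps :: "'n::finite set \<Rightarrow> real^'n" where
  "cw_eps P = (\<chi> i. if i \<in> P then 1 else - 1)"

text \<open>This is \<open>L^2\<close>, which multiplies the real and the imaginary part of each
  coordinate by the same number. It is also the coefficient vector of the quadratic form in the
  metric.\<close>

definition cw_sig :: "'n::finite set \<Rightarrow> real^'n \<Rightarrow> real^'n" where
  "cw_sig P \<nu> = cw_eps P * \<nu> * \<nu>"

text \<open>The exponential of \<open>L\<close> acts on both kinds of indices by one formula, in which the functions
  below are \<open>cosh, sinh\<close> or \<open>cos, sin\<close> according to the sign \<open>cw_eps\<close>. The product of vectors is
  componentwise throughout.\<close>

definition cw_C :: "'n::finite set \<Rightarrow> real^'n \<Rightarrow> real \<Rightarrow> real^'n" where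
  "cw_C P \<nu> t = (\<chi> i. if i \<in> P then cosh (\<nu> $ i * t) else cos (\<nu> $ i * t))"

definition cw_S :: "'n::finite set \<Rightarrow> real^'n \<Rightarrow> real \<Rightarrow> real^'n" where
  "cw_S P \<nu> t = (\<chi> i. if i \<in> P then sinh (\<nu> $ i * t) else sin (\<nu> $ i * t))"

lemma vRe_cvec [simp]: "vRe (cvec b c) = b"
  and vIm_cvec [simp]: "vIm (cvec b c) = c"
  and cvec_vRe_vIm [simp]: "cvec (vRe a) (vIm a) = a"
  by (simp_all add: vRe_def vIm_def cvec_def)

lemma cvec_eq_iff [simp]: "cvec b c = cvec b' c' \<longleftrightarrow> b = b' \<and> c = c'"
  by (metis vRe_cvec vIm_cvec)

lemma cvec_0 [simp]: "cvec 0 0 = 0"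
  by (simp add: cvec_def vec_eq_iff complex_eq_iff)

lemma cvec_add: "cvec b c + cvec b' c' = cvec (b + b') (c + c')"
  and cvec_scaleR: "r *\<^sub>R cvec b c = cvec (r *\<^sub>R b) (r *\<^sub>R c)"
  by (simp_all add: cvec_def vec_eq_iff complex_eq_iff)

lemma bounded_linear_vRe: "bounded_linear vRe"
  and bounded_linear_vIm: "bounded_linear vIm"
  by (auto simp: vRe_def vIm_def vec_eq_iff intro!: linear_conv_bounded_linear[THEN iffD1] linearI)

lemma bounded_linear_cvec: "bounded_linear (\<lambda>p. cvec (fst p) (snd p))"
  by (auto simp: cvec_def vec_eq_iff complex_eq_iff intro!: linear_conv_bounded_linear[THEN iffD1] linearI)

lemma cvec_imaginary: "(\<chi> i. \<i> * of_real (x $ i)) = cvec 0 x"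
  by (simp add: cvec_def vec_eq_iff complex_eq_iff)

lemma cw_aplus_eq: "cw_aplus = range (\<lambda>b. cvec b 0)"
proof -
  have "a \<in> cw_aplus \<longleftrightarrow> a = cvec (vRe a) 0" for a :: "complex^'n"
    by (simp add: cw_aplus_def cvec_def vRe_def vec_eq_iff complex_eq_iff complex_is_Real_iff)
  moreover have "cvec b 0 = cvec (vRe (cvec b 0)) 0" for b :: "real^'n"
    by simp
  ultimately show ?thesis
    by (blast intro: rangeI)
qed

lemma cw_theta_cvec: "cw_theta (cvec b c) = cvec b (- c)"
  by (simp add: cw_theta_def cvec_def vec_eq_iff complex_eq_iff)

lemma cw_L_cvec: "cw_L P \<nu> (cvec b c) = cvec (cw_eps P * \<nu> * c) (\<nu> * b)"
  by (simp add: cw_L_def cvec_def cw_eps_def vec_eq_iff complex_eq_iff)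

lemma cw_ip_cvec: "cw_ip P (cvec b c) (cvec b' c') = c \<bullet> c' - (cw_eps P * b) \<bullet> b'"
proof -
  have "cw_ip P (cvec b c) (cvec b' c')
      = (\<Sum>i\<in>P. c$i * c'$i - (cw_eps P * b)$i * b'$i) + (\<Sum>i\<in>-P. c$i * c'$i - (cw_eps P * b)$i * b'$i)"
    unfolding cw_ip_def Re_sum sum_negf[symmetric]
    by (intro arg_cong2[where f="(+)"] sum.cong) (auto simp: cvec_def cw_eps_def)
  also have "\<dots> = (\<Sum>i\<in>UNIV. c$i * c'$i - (cw_eps P * b)$i * b'$i)"
    by (subst sum.union_disjoint[symmetric]) auto
  finally show ?thesis
    by (simp add: inner_vec_def sum_subtractf)
qed

lemma cw_eps_square [simp]: "cw_eps P * cw_eps P = 1" "cw_eps P * (cw_eps P * x) = x"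
  by (auto simp: cw_eps_def vec_eq_iff)

lemma inner_vec_mult: "(x * y) \<bullet> (z::real^'n) = y \<bullet> (x * z)"
  by (simp add: inner_vec_def mult_ac)

lemma cw_omega_cvec: "cw_omega P \<nu> (cvec b c) (cvec b' c') = (\<nu> * b) \<bullet> c' - (\<nu> * c) \<bullet> b'"
  unfolding cw_omega_def cw_L_cvec cw_ip_cvec by (simp add: mult.assoc)

section \<open>The one-parameter group generated by \<open>L\<close>\<close>

lemma cw_C_0 [simp]: "cw_C P \<nu> 0 = 1" and cw_S_0 [simp]: "cw_S P \<nu> 0 = 0"
  by (auto simp: cw_C_def cw_S_def vec_eq_iff)

lemma cw_C_add: "cw_C P \<nu> (s + t) = cw_C P \<nu> s * cw_C P \<nu> t + cw_eps P * cw_S P \<nu> s * cw_S P \<nu> t"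
  and cw_S_add: "cw_S P \<nu> (s + t) = cw_S P \<nu> s * cw_C P \<nu> t + cw_C P \<nu> s * cw_S P \<nu> t"
  by (auto simp: cw_C_def cw_S_def cw_eps_def vec_eq_iff distrib_left cos_add sin_add cosh_add sinh_add)

lemma cw_C_S_square: "cw_C P \<nu> t * cw_C P \<nu> t - cw_eps P * cw_S P \<nu> t * cw_S P \<nu> t = 1"
proof -
  have "cosh x * cosh x - sinh x * sinh x = 1" "cos x * cos x + sin x * sin x = 1" for x :: real
    using cosh_square_eq[of x] sin_cos_squared_add3[of x] by (auto simp: power2_eq_square)
  then show ?thesis
    by (auto simp: cw_C_def cw_S_def cw_eps_def vec_eq_iff)
qed

lemma has_vector_derivative_vec:
  assumes "\<And>i. ((\<lambda>t. f t $ i) has_real_derivative f' $ i) (at x within X)"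
  shows "(f has_vector_derivative f') (at x within X)"
  using assms unfolding has_vector_derivative_def
  by (subst has_derivative_componentwise_within)
     (auto simp: Basis_vec_def inner_axis has_field_derivative_def mult_commute_abs)

lemma cw_C_deriv: "(cw_C P \<nu> has_vector_derivative cw_eps P * \<nu> * cw_S P \<nu> t) (at t within X)"
  and cw_S_deriv: "(cw_S P \<nu> has_vector_derivative \<nu> * cw_C P \<nu> t) (at t within X)"
proof -
  show "(cw_C P \<nu> has_vector_derivative cw_eps P * \<nu> * cw_S P \<nu> t) (at t within X)"
  proof (rule has_vector_derivative_vec)
    show "((\<lambda>t. cw_C P \<nu> t $ i) has_real_derivative (cw_eps P * \<nu> * cw_S P \<nu> t) $ i) (at t within X)" for i
      by (cases "i \<in> P") (auto simp: cw_C_def cw_S_def cw_eps_def intro!: derivative_eq_intros)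
  qed
  show "(cw_S P \<nu> has_vector_derivative \<nu> * cw_C P \<nu> t) (at t within X)"
  proof (rule has_vector_derivative_vec)
    show "((\<lambda>t. cw_S P \<nu> t $ i) has_real_derivative (\<nu> * cw_C P \<nu> t) $ i) (at t within X)" for i
      by (cases "i \<in> P") (auto simp: cw_C_def cw_S_def cw_eps_def intro!: derivative_eq_intros)
  qed
qed

text \<open>On \<open>P\<close> the map is antilinear with square \<open>\<nu>^2\<close>, so the
  conjugation survives exactly in the odd powers. Off \<open>P\<close> it is multiplication by an
  imaginary number.\<close>

lemma cw_L_pow: "(cw_L P \<nu> ^^ k) a $ i = (if i \<in> P
     then of_real (\<nu> $ i ^ k) * (if even k then a $ i else \<i> * cnj (a $ i))
     else (\<i> * of_real (\<nu> $ i)) ^ k * a $ i)"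
  by (induction k) (auto simp: cw_L_def)

lemma sums_vec:
  assumes "\<And>i. (\<lambda>k. f k $ i) sums (s $ i)"
  shows "f sums s"
  using assms unfolding sums_def by (intro vec_tendstoI) simp

text \<open>On \<open>P\<close> the even and odd terms form the series of cosh and sinh; off
  \<open>P\<close> the series is that of a complex exponential.\<close>

lemma cw_expL_sums: "(\<lambda>k. (t ^ k / fact k) *\<^sub>R (cw_L P \<nu> ^^ k) a) sums
   cvec (cw_C P \<nu> t * vRe a + cw_eps P * cw_S P \<nu> t * vIm a) (cw_C P \<nu> t * vIm a + cw_S P \<nu> t * vRe a)"
proof (rule sums_vec)
  fix i
  let ?x = "\<nu> $ i * t"
  show "(\<lambda>k. ((t ^ k / fact k) *\<^sub>R (cw_L P \<nu> ^^ k) a) $ i) sums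
   (cvec (cw_C P \<nu> t * vRe a + cw_eps P * cw_S P \<nu> t * vIm a) (cw_C P \<nu> t * vIm a + cw_S P \<nu> t * vRe a) $ i)"
  proof (cases "i \<in> P")
    case True
    have "(\<lambda>k. of_real (if even k then ?x ^ k /\<^sub>R fact k else 0) * a $ i
        + of_real (if even k then 0 else ?x ^ k /\<^sub>R fact k) * (\<i> * cnj (a $ i)))
      sums (of_real (cosh ?x) * a $ i + of_real (sinh ?x) * (\<i> * cnj (a $ i)))"
      by (intro sums_add sums_mult2 sums_of_real cosh_converges sinh_converges)
    moreover have "((t ^ k / fact k) *\<^sub>R (cw_L P \<nu> ^^ k) a) $ i
       = of_real (if even k then ?x ^ k /\<^sub>R fact k else 0) * a $ i
        + of_real (if even k then 0 else ?x ^ k /\<^sub>R fact k) * (\<i> * cnj (a $ i))" for k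
      using True unfolding vector_scaleR_component by (simp add: cw_L_pow scaleR_conv_of_real power_mult_distrib field_simps)
    moreover have "of_real (cosh ?x) * a $ i + of_real (sinh ?x) * (\<i> * cnj (a $ i))
      = cvec (cw_C P \<nu> t * vRe a + cw_eps P * cw_S P \<nu> t * vIm a) (cw_C P \<nu> t * vIm a + cw_S P \<nu> t * vRe a) $ i"
      using True by (simp add: complex_eq_iff cvec_def cw_C_def cw_S_def cw_eps_def vRe_def vIm_def)
    ultimately show ?thesis
      by simp
  next
    case False
    have "(\<lambda>k. (\<i> * of_real ?x) ^ k /\<^sub>R fact k * a $ i) sums (exp (\<i> * of_real ?x) * a $ i)"
      by (intro sums_mult2 exp_converges)
    moreover have "((t ^ k / fact k) *\<^sub>R (cw_L P \<nu> ^^ k) a) $ i = (\<i> * of_real ?x) ^ k /\<^sub>R fact k * a $ i" for k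
      using False unfolding vector_scaleR_component by (simp add: cw_L_pow scaleR_conv_of_real power_mult_distrib field_simps)
    moreover have "exp (\<i> * of_real ?x) * a $ i
      = cvec (cw_C P \<nu> t * vRe a + cw_eps P * cw_S P \<nu> t * vIm a) (cw_C P \<nu> t * vIm a + cw_S P \<nu> t * vRe a) $ i"
      using False by (simp add: complex_eq_iff cvec_def cw_C_def cw_S_def cw_eps_def vRe_def vIm_def Re_exp Im_exp)
    ultimately show ?thesis
      by simp
  qed
qed

lemma cw_expL_cvec: "cw_expL P \<nu> t (cvec b c) =
   cvec (cw_C P \<nu> t * b + cw_eps P * cw_S P \<nu> t * c) (cw_C P \<nu> t * c + cw_S P \<nu> t * b)"
  using sums_unique[OF cw_expL_sums[of t P \<nu> "cvec b c"]] by (simp add: cw_expL_def)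

lemma cw_expL_0 [simp]: "cw_expL P \<nu> 0 a = a"
  using cw_expL_cvec[of P \<nu> 0 "vRe a" "vIm a"] by simp

lemma cw_expL_expL [simp]: "cw_expL P \<nu> s (cw_expL P \<nu> t a) = cw_expL P \<nu> (s + t) a"
proof -
  have "cw_expL P \<nu> s (cw_expL P \<nu> t (cvec b c)) = cw_expL P \<nu> (s + t) (cvec b c)" for b c
    by (simp add: cw_expL_cvec cw_C_add cw_S_add algebra_simps)
  from this[of "vRe a" "vIm a"] show ?thesis
    by simp
qed

lemma cw_expL_add: "cw_expL P \<nu> t (a + a') = cw_expL P \<nu> t a + cw_expL P \<nu> t a'"
proof -
  have "cw_expL P \<nu> t (cvec b c + cvec b' c') = cw_expL P \<nu> t (cvec b c) + cw_expL P \<nu> t (cvec b' c')" for b c b' c'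
    by (simp add: cw_expL_cvec cvec_add algebra_simps)
  from this[of "vRe a" "vIm a" "vRe a'" "vIm a'"] show ?thesis
    by simp
qed

text \<open>In each coordinate omega is \<open>\<nu>\<close> times the area form of the real plane,
  and the exponential is a matrix of determinant \<open>C^2 - eps S^2 = 1\<close>.\<close>

lemma cw_omega_expL: "cw_omega P \<nu> (cw_expL P \<nu> t a) (cw_expL P \<nu> t a') = cw_omega P \<nu> a a'"
proof -
  have sq: "c * c = 1 + e * s * s" if "c = cw_C P \<nu> t $ i" "s = cw_S P \<nu> t $ i" "e = cw_eps P $ i" for c s e i
    using arg_cong[OF cw_C_S_square[of P \<nu> t], of "\<lambda>v. v $ i"] that by simp
  have comp: "n * (c * b + e * s * d) * (c * d' + s * b') - n * (c * d + s * b) * (c * b' + e * s * d')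
     = n * b * d' - n * d * b'" if "c * c = 1 + e * s * s" for n c s e b d b' d' :: real
  proof -
    have "n * (c * b + e * s * d) * (c * d' + s * b') - n * (c * d + s * b) * (c * b' + e * s * d')
      = (c * c - e * s * s) * (n * b * d' - n * d * b')"
      by (simp add: algebra_simps)
    then show ?thesis using that by simp
  qed
  have "cw_omega P \<nu> (cw_expL P \<nu> t (cvec b c)) (cw_expL P \<nu> t (cvec b' c')) = cw_omega P \<nu> (cvec b c) (cvec b' c')"
    for b c b' c'
    unfolding cw_expL_cvec cw_omega_cvec inner_vec_def sum_subtractf[symmetric]
    by (rule sum.cong) (simp_all add: comp[OF sq[OF refl refl refl]])
  from this[of "vRe a" "vIm a" "vRe a'" "vIm a'"] show ?thesis
    by simp
qed

subsection \<open>The group and its action\<close>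

text \<open>Serves three times: for the transvection group, for \<open>G\<close>, and for the group
  with which the holonomy is compared.\<close>

lemma semidirect_group:
  assumes N: "group N" and Q: "group Q"
    and hom: "\<And>h. h \<in> carrier Q \<Longrightarrow> \<alpha> h \<in> hom N N"
    and mult: "\<And>h h' n. h \<in> carrier Q \<Longrightarrow> h' \<in> carrier Q \<Longrightarrow> n \<in> carrier N \<Longrightarrow>
      \<alpha> (h \<otimes>\<^bsub>Q\<^esub> h') n = \<alpha> h (\<alpha> h' n)"
    and one: "\<And>n. n \<in> carrier N \<Longrightarrow> \<alpha> \<one>\<^bsub>Q\<^esub> n = n"
  shows "group (semidirect N Q \<alpha>)"
proof -
  interpret N: group N by fact
  interpret Q: group Q by fact
  have closed: "\<alpha> h n \<in> carrier N" if "h \<in> carrier Q" "n \<in> carrier N" for h n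
    using hom[OF that(1)] that(2) by (auto simp: hom_def)
  have distrib: "\<alpha> h (n \<otimes>\<^bsub>N\<^esub> n') = \<alpha> h n \<otimes>\<^bsub>N\<^esub> \<alpha> h n'"
    if "h \<in> carrier Q" "n \<in> carrier N" "n' \<in> carrier N" for h n n'
    using hom[OF that(1)] that(2,3) by (auto simp: hom_def)
  have \<alpha>_one: "\<alpha> h \<one>\<^bsub>N\<^esub> = \<one>\<^bsub>N\<^esub>" if "h \<in> carrier Q" for h
    by (metis that distrib closed N.one_closed N.r_one N.r_cancel_one)
  show ?thesis
  proof (rule groupI)
    show "\<exists>y\<in>carrier (semidirect N Q \<alpha>). y \<otimes>\<^bsub>semidirect N Q \<alpha>\<^esub> x = \<one>\<^bsub>semidirect N Q \<alpha>\<^esub>"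
      if "x \<in> carrier (semidirect N Q \<alpha>)" for x
    proof -
      obtain n h where x: "x = (n, h)" and n: "n \<in> carrier N" and h: "h \<in> carrier Q"
        using \<open>x \<in> _\<close> by (auto simp: semidirect_def)
      show ?thesis
        using n h by (intro bexI[of _ "(\<alpha> (inv\<^bsub>Q\<^esub> h) (inv\<^bsub>N\<^esub> n), inv\<^bsub>Q\<^esub> h)"])
          (auto simp: semidirect_def x closed \<alpha>_one simp flip: distrib)
    qed
  qed (auto simp: semidirect_def closed distrib mult one N.m_assoc Q.m_assoc)
qed

lemma real_add_group: "group \<lparr>carrier = UNIV, mult = (+), one = (0::real)\<rparr>"
proof (rule groupI)
  show "\<exists>y\<in>carrier \<lparr>carrier = UNIV, mult = (+), one = (0::real)\<rparr>.
      y \<otimes>\<^bsub>\<lparr>carrier = UNIV, mult = (+), one = (0::real)\<rparr>\<^esub> x = \<one>\<^bsub>\<lparr>carrier = UNIV, mult = (+), one = (0::real)\<rparr>\<^esub>" for x :: real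
    by (rule bexI[of _ "- x"]) auto
qed auto

lemma cw_omega_add:
  "cw_omega P \<nu> (a + b) c = cw_omega P \<nu> a c + cw_omega P \<nu> b c"
  "cw_omega P \<nu> c (a + b) = cw_omega P \<nu> c a + cw_omega P \<nu> c b"
proof -
  have "cw_omega P \<nu> (cvec x y + cvec x' y') (cvec u v) = cw_omega P \<nu> (cvec x y) (cvec u v) + cw_omega P \<nu> (cvec x' y') (cvec u v)"
    "cw_omega P \<nu> (cvec u v) (cvec x y + cvec x' y') = cw_omega P \<nu> (cvec u v) (cvec x y) + cw_omega P \<nu> (cvec u v) (cvec x' y')"
    for x y x' y' u v
    by (simp_all add: cvec_add cw_omega_cvec algebra_simps)
  from this[where x="vRe a" and y="vIm a" and x'="vRe b" and y'="vIm b" and u="vRe c" and v="vIm c"]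
  show "cw_omega P \<nu> (a + b) c = cw_omega P \<nu> a c + cw_omega P \<nu> b c"
    "cw_omega P \<nu> c (a + b) = cw_omega P \<nu> c a + cw_omega P \<nu> c b"
    by simp_all
qed

lemma cw_omega_self: "cw_omega P \<nu> a (- a) = 0"
  and cw_omega_0 [simp]: "cw_omega P \<nu> 0 a = 0" "cw_omega P \<nu> a 0 = 0"
proof -
  show 0: "cw_omega P \<nu> 0 a = 0" "cw_omega P \<nu> a 0 = 0" for a
    using cw_omega_add(1)[of P \<nu> 0 0 a] cw_omega_add(2)[of P \<nu> a 0 0] by simp_all
  have "cw_omega P \<nu> (cvec b c) (cvec b c) = 0" for b c
    unfolding cw_omega_cvec by (simp add: inner_vec_def mult_ac)
  from this[of "vRe a" "vIm a"] show "cw_omega P \<nu> a (- a) = 0"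
    using cw_omega_add(2)[of P \<nu> a a "- a"] by (simp add: 0)
qed

lemma cw_heisenberg_group: "group (cw_heisenberg P \<nu>)"
proof (rule groupI)
  show "\<exists>y\<in>carrier (cw_heisenberg P \<nu>). y \<otimes>\<^bsub>cw_heisenberg P \<nu>\<^esub> x = \<one>\<^bsub>cw_heisenberg P \<nu>\<^esub>" for x
    using cw_omega_self[of P \<nu> "- snd x"]
    by (intro bexI[of _ "(- fst x, - snd x)"]) (auto simp: cw_heisenberg_def split: prod.splits)
qed (auto simp: cw_heisenberg_def cw_omega_add add_divide_distrib algebra_simps)

lemma cw_Ghat_group: "group (cw_Ghat P \<nu>)"
  unfolding cw_Ghat_def
  by (rule semidirect_group[OF cw_heisenberg_group real_add_group])
     (auto simp: hom_def cw_heisenberg_def cw_expL_add cw_omega_expL)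

lemma cw_K_carrierD:
  assumes "\<phi> \<in> carrier (cw_K P \<nu>)"
  shows "bij (blinfun_apply \<phi>)" "cw_ip P (\<phi> a) (\<phi> b) = cw_ip P a b"
    "cw_theta (\<phi> a) = \<phi> (cw_theta a)" "cw_L P \<nu> (\<phi> a) = \<phi> (cw_L P \<nu> a)"
  using assms by (auto simp: cw_K_def)

lemma blinfun_inverse:
  fixes \<phi> :: "'a::euclidean_space \<Rightarrow>\<^sub>L 'b::euclidean_space"
  assumes "bij (blinfun_apply \<phi>)"
  obtains \<psi> :: "'b \<Rightarrow>\<^sub>L 'a" where "\<And>x. \<psi> (\<phi> x) = x" "\<And>x. \<phi> (\<psi> x) = x"
proof -
  let ?\<psi> = "inv_into UNIV (blinfun_apply \<phi>)"
  have \<psi>: "?\<psi> (\<phi> x) = x" "\<phi> (?\<psi> y) = y" for x y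
    using assms by (simp_all add: bij_is_inj bij_is_surj surj_f_inv_f)
  have "linear ?\<psi>"
  proof (rule linearI)
    show "?\<psi> (x + y) = ?\<psi> x + ?\<psi> y" for x y
      using \<psi>(1)[of "?\<psi> x + ?\<psi> y"] by (simp add: blinfun.add_right \<psi>(2))
    show "?\<psi> (c *\<^sub>R x) = c *\<^sub>R ?\<psi> x" for c x
      using \<psi>(1)[of "c *\<^sub>R ?\<psi> x"] by (simp add: blinfun.scaleR_right \<psi>(2))
  qed
  then show ?thesis
    using that[of "Blinfun ?\<psi>"] \<psi> by (simp add: bounded_linear_Blinfun_apply linear_conv_bounded_linear)
qed

lemma cw_K_group: "group (cw_K P \<nu>)"
proof (rule groupI)
  show "\<phi> \<otimes>\<^bsub>cw_K P \<nu>\<^esub> \<psi> \<in> carrier (cw_K P \<nu>)" 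
    if "\<phi> \<in> carrier (cw_K P \<nu>)" "\<psi> \<in> carrier (cw_K P \<nu>)" for \<phi> \<psi>
    using that bij_comp[of "blinfun_apply \<psi>" "blinfun_apply \<phi>"]
    by (auto simp: cw_K_def blinfun_compose.rep_eq)
  show "\<exists>\<psi>\<in>carrier (cw_K P \<nu>). \<psi> \<otimes>\<^bsub>cw_K P \<nu>\<^esub> \<phi> = \<one>\<^bsub>cw_K P \<nu>\<^esub>" if \<phi>: "\<phi> \<in> carrier (cw_K P \<nu>)" for \<phi>
  proof -
    note K = cw_K_carrierD[OF \<phi>]
    obtain \<psi> :: "'a cw_end" where \<psi>: "\<And>x. \<psi> (\<phi> x) = x" "\<And>x. \<phi> (\<psi> x) = x"
      using blinfun_inverse[OF K(1)] by metis
    have "bij (blinfun_apply \<psi>)"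
      using \<psi> by (intro bijI' ) metis+
    moreover have "cw_ip P (\<psi> a) (\<psi> b) = cw_ip P a b" for a b
      using K(2)[of "\<psi> a" "\<psi> b"] \<psi> by simp
    moreover have "cw_theta (\<psi> a) = \<psi> (cw_theta a)" for a
      using K(3)[of "\<psi> a"] \<psi> by metis
    moreover have "cw_L P \<nu> (\<psi> a) = \<psi> (cw_L P \<nu> a)" for a
      using K(4)[of "\<psi> a"] \<psi> by metis
    moreover have "\<psi> o\<^sub>L \<phi> = id_blinfun"
      using \<psi> by (intro blinfun_eqI) simp
    ultimately show ?thesis
      by (intro bexI[of _ \<psi>]) (simp_all add: cw_K_def)
  qed
qed (auto simp: cw_K_def intro!: blinfun_eqI bij_id[unfolded id_def])

lemma cw_omega_K:
  assumes "\<phi> \<in> carrier (cw_K P \<nu>)"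
  shows "cw_omega P \<nu> (\<phi> a) (\<phi> b) = cw_omega P \<nu> a b"
  using cw_K_carrierD[OF assms] by (simp add: cw_omega_def)

text \<open>A bounded linear map passes through the exponential series, and \<phi> commutes with
  every power of \<open>L\<close>.\<close>

lemma cw_expL_K:
  assumes "\<phi> \<in> carrier (cw_K P \<nu>)"
  shows "\<phi> (cw_expL P \<nu> t a) = cw_expL P \<nu> t (\<phi> a)"
proof -
  have pow: "\<phi> ((cw_L P \<nu> ^^ k) a) = (cw_L P \<nu> ^^ k) (\<phi> a)" for k
    by (induction k) (simp_all flip: cw_K_carrierD(4)[OF assms])
  have "(\<lambda>k. \<phi> ((t ^ k / fact k) *\<^sub>R (cw_L P \<nu> ^^ k) a)) sums \<phi> (cw_expL P \<nu> t a)"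
    unfolding cw_expL_def
    by (intro bounded_linear.sums[OF blinfun.bounded_linear_right] summable_sums sums_summable[OF cw_expL_sums])
  then show ?thesis
    unfolding cw_expL_def[of P \<nu> t "\<phi> a"] by (simp add: blinfun.scaleR_right pow sums_iff)
qed

lemma cw_G_mult:
  "(((z, a), t), \<phi>) \<otimes>\<^bsub>cw_G P \<nu>\<^esub> (((z', a'), t'), \<phi>') =
    (((z + z' + 1/2 * cw_omega P \<nu> a (cw_expL P \<nu> t (\<phi> a')), a + cw_expL P \<nu> t (\<phi> a')), t + t'), \<phi> o\<^sub>L \<phi>')"
  by (simp add: cw_G_def semidirect_def cw_Ghat_def cw_heisenberg_def cw_K_def cw_K_act_def)

lemma cw_G_carrier: "(g, \<phi>) \<in> carrier (cw_G P \<nu>) \<longleftrightarrow> \<phi> \<in> carrier (cw_K P \<nu>)"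
  by (simp add: cw_G_def semidirect_def cw_Ghat_def cw_heisenberg_def)

lemma cw_G_one: "\<one>\<^bsub>cw_G P \<nu>\<^esub> = (((0, 0), 0), id_blinfun)"
  by (simp add: cw_G_def semidirect_def cw_Ghat_def cw_heisenberg_def cw_K_def)

lemma cw_K_act_hom:
  assumes "\<phi> \<in> carrier (cw_K P \<nu>)"
  shows "cw_K_act \<phi> \<in> hom (cw_Ghat P \<nu>) (cw_Ghat P \<nu>)"
  by (auto simp: hom_def cw_Ghat_def semidirect_def cw_heisenberg_def cw_K_act_def blinfun.add_right
      cw_omega_K[OF assms] cw_expL_K[OF assms] simp flip: cw_expL_K[OF assms])

lemma cw_G_group: "group (cw_G P \<nu>)"
  unfolding cw_G_def
  by (rule semidirect_group[OF cw_Ghat_group cw_K_group cw_K_act_hom])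
     (auto simp: cw_K_act_def cw_K_def)

section \<open>The two blocks of an element of \<open>K\<close>\<close>

definition cw_A :: "'n::finite cw_end \<Rightarrow> real^'n \<Rightarrow> real^'n" where
  "cw_A \<phi> x = vIm (\<phi> (cvec 0 x))"

definition cw_B :: "'n::finite cw_end \<Rightarrow> real^'n \<Rightarrow> real^'n" where
  "cw_B \<phi> x = vRe (\<phi> (cvec x 0))"

text \<open>Real and imaginary vectors are the eigenspaces of the conjugation for 1 and -1, so a map
  commuting with it is block diagonal. The block \<open>cw_A\<close> acts on the directions of
  \<open>X\<close>, the block \<open>cw_B\<close> on the translations in the stabiliser.\<close>

lemma cw_K_cvec:
  assumes "\<phi> \<in> carrier (cw_K P \<nu>)"
  shows "\<phi> (cvec b c) = cvec (cw_B \<phi> b) (cw_A \<phi> c)"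
proof -
  have theta: "cw_theta a = cvec (vRe a) (- vIm a)" for a :: "complex^'a"
    using cw_theta_cvec[of "vRe a" "vIm a"] by simp
  have "vIm (\<phi> (cvec b 0)) = 0"
  proof -
    have "vIm (cw_theta (\<phi> (cvec b 0))) = vIm (\<phi> (cvec b 0))"
      using cw_K_carrierD(3)[OF assms, of "cvec b 0"] by (simp add: cw_theta_cvec)
    then show ?thesis
      by (simp add: theta vec_eq_iff)
  qed
  moreover have "vRe (\<phi> (cvec 0 c)) = 0"
  proof -
    have "cvec 0 (- c) = - cvec 0 c"
      using cvec_scaleR[of "-1" 0 c] by simp
    then have "cw_theta (\<phi> (cvec 0 c)) = - \<phi> (cvec 0 c)"
      using cw_K_carrierD(3)[OF assms, of "cvec 0 c"] by (simp add: cw_theta_cvec blinfun.minus_right)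
    then have "vRe (\<phi> (cvec 0 c)) = vRe (- \<phi> (cvec 0 c))"
      by (metis theta vRe_cvec)
    also have "\<dots> = - vRe (\<phi> (cvec 0 c))"
      by (simp add: vRe_def vec_eq_iff)
    finally show ?thesis
      by (simp add: vec_eq_iff)
  qed
  ultimately have *: "\<phi> (cvec b 0) = cvec (cw_B \<phi> b) 0" "\<phi> (cvec 0 c) = cvec 0 (cw_A \<phi> c)"
    unfolding cw_A_def cw_B_def by (metis cvec_vRe_vIm)+
  have "\<phi> (cvec b c) = \<phi> (cvec b 0 + cvec 0 c)"
    by (simp add: cvec_add)
  also have "\<dots> = cvec (cw_B \<phi> b) (cw_A \<phi> c)"
    unfolding blinfun.add_right * by (simp add: cvec_add)
  finally show ?thesis .
qed

lemma bounded_linear_cvec_0: "bounded_linear (cvec 0)" "bounded_linear (\<lambda>b. cvec b 0)"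
  using bounded_linear_compose[OF bounded_linear_cvec bounded_linear_Pair[OF bounded_linear_zero bounded_linear_ident]]
    bounded_linear_compose[OF bounded_linear_cvec bounded_linear_Pair[OF bounded_linear_ident bounded_linear_zero]]
  by auto

lemma bounded_linear_cw_A: "bounded_linear (cw_A \<phi>)"
  unfolding cw_A_def
  by (intro bounded_linear_compose[OF bounded_linear_vIm] bounded_linear_compose[OF blinfun.bounded_linear_right]
      bounded_linear_cvec_0)

lemma bounded_linear_cw_B: "bounded_linear (cw_B \<phi>)"
  unfolding cw_B_def
  by (intro bounded_linear_compose[OF bounded_linear_vRe] bounded_linear_compose[OF blinfun.bounded_linear_right]
      bounded_linear_cvec_0)

lemma cw_A_0 [simp]: "cw_A \<phi> 0 = 0" and cw_B_0 [simp]: "cw_B \<phi> 0 = 0"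
  by (simp_all add: cw_A_def cw_B_def vIm_def vRe_def vec_eq_iff)

lemma cw_A_inner:
  assumes "\<phi> \<in> carrier (cw_K P \<nu>)"
  shows "cw_A \<phi> x \<bullet> cw_A \<phi> y = x \<bullet> y"
  using cw_K_carrierD(2)[OF assms, of "cvec 0 x" "cvec 0 y"]
  by (simp add: cw_K_cvec[OF assms] cw_ip_cvec)

text \<open>\<open>L\<close> exchanges real and imaginary vectors, so commuting with it ties the two
  blocks together. Evaluating at a vector with equal real and imaginary parts yields both identities
  at once.\<close>

lemma cw_A_B:
  assumes "\<phi> \<in> carrier (cw_K P \<nu>)"
  shows "\<nu> * cw_B \<phi> x = cw_A \<phi> (\<nu> * x)" "cw_B \<phi> (cw_eps P * \<nu> * x) = cw_eps P * \<nu> * cw_A \<phi> x"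
  using cw_K_carrierD(4)[OF assms, of "cvec x x"] by (simp_all add: cw_K_cvec[OF assms] cw_L_cvec)

text \<open>Two applications of the previous relations, that is, commutation with
  \<open>L^2\<close>. Together with orthogonality it says that \<open>cw_A\<close> preserves the
  quadratic form in the metric.\<close>

lemma cw_A_sig:
  assumes "\<phi> \<in> carrier (cw_K P \<nu>)"
  shows "cw_A \<phi> (cw_sig P \<nu> * x) = cw_sig P \<nu> * cw_A \<phi> x"
  using cw_A_B[OF assms, of "cw_eps P * \<nu> * x"] cw_A_B[OF assms, of x]
  by (simp add: cw_sig_def mult_ac)

lemma cw_A_compose:
  assumes "\<psi> \<in> carrier (cw_K P \<nu>)"
  shows "cw_A (\<phi> o\<^sub>L \<psi>) x = cw_A \<phi> (cw_A \<psi> x)"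
  using cw_K_cvec[OF assms] by (simp add: cw_A_def[of \<phi>] cw_A_def[of "\<phi> o\<^sub>L \<psi>"])

lemma cw_A_id [simp]: "cw_A id_blinfun x = x" "cw_B id_blinfun x = x"
  by (simp_all add: cw_A_def cw_B_def)

section \<open>The action of \<open>G\<close> in the coordinates of \<open>X\<close>\<close>

lemma cw_section_eq: "cw_section P \<nu> (x0, x1, x) = (((x0, cw_expL P \<nu> x1 (cvec 0 x)), x1), id_blinfun)"
  by (simp add: cw_section_def cvec_imaginary cw_Ghat_def semidirect_def cw_heisenberg_def)

lemma cw_stabiliser_eq: "cw_stabiliser P \<nu> = {(((0, cvec b 0), 0), \<psi>) |b \<psi>. \<psi> \<in> carrier (cw_K P \<nu>)}"
  by (auto simp: cw_stabiliser_def semidirect_def cw_Ghat_plus_def cw_aplus_eq)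

text \<open>Here \<open>b + \<i> c\<close> is \<open>a\<close> rotated back to the time
  \<open>t + x1\<close>. The imaginary part \<open>c\<close> moves the point; the real part
  \<open>b\<close> is absorbed by the stabiliser. Half of the term
  \<open>(\<nu> * b) \<bullet> cw_A \<phi> x\<close> comes from the product with the section, the
  other half from removing the stabiliser element.\<close>

definition cw_map :: "'n::finite set \<Rightarrow> real^'n \<Rightarrow> 'n cw_transvection \<times> 'n cw_end \<Rightarrow> 'n cw_point \<Rightarrow> 'n cw_point"
  where "cw_map P \<nu> = (\<lambda>(((z, a), t), \<phi>) (x0, x1, x).
    let b = vRe (cw_expL P \<nu> (- (t + x1)) a); c = vIm (cw_expL P \<nu> (- (t + x1)) a)
    in (z + x0 + (\<nu> * b) \<bullet> cw_A \<phi> x + 1/2 * ((\<nu> * b) \<bullet> c), t + x1, c + cw_A \<phi> x))"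

lemma blinfun_compose_id [simp]: "\<phi> o\<^sub>L id_blinfun = \<phi>" "id_blinfun o\<^sub>L \<phi> = \<phi>"
  by (auto intro: blinfun_eqI)

text \<open>Existence and uniqueness of the coset representative in one statement, which justifies
  the definite description in \<open>cw_act\<close>. Writing \<open>a\<close> as an exponential
  applied to \<open>b + \<i> c\<close> lets the invariance of omega remove all exponentials from the
  central coordinate.\<close>

lemma cw_coset_iff:
  assumes "g \<in> carrier (cw_G P \<nu>)"
  shows "g \<otimes>\<^bsub>cw_G P \<nu>\<^esub> cw_section P \<nu> p \<in> cw_section P \<nu> q <#\<^bsub>cw_G P \<nu>\<^esub> cw_stabiliser P \<nu>
    \<longleftrightarrow> q = cw_map P \<nu> g p"
proof -
  obtain z a t \<phi> where g: "g = (((z, a), t), \<phi>)"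
    by (metis surj_pair)
  obtain x0 x1 x y0 y1 y where p: "p = (x0, x1, x)" and q: "q = (y0, y1, y)"
    by (metis surj_pair)
  have \<phi>: "\<phi> \<in> carrier (cw_K P \<nu>)"
    using assms by (simp add: g cw_G_carrier)
  define s where "s = t + x1"
  define b c where "b = vRe (cw_expL P \<nu> (- s) a)" and "c = vIm (cw_expL P \<nu> (- s) a)"
  have a: "a = cw_expL P \<nu> s (cvec b c)"
    by (simp add: b_def c_def)
  have inj: "cw_expL P \<nu> s u = cw_expL P \<nu> s v \<longleftrightarrow> u = v" for u v
    by (metis cw_expL_expL cw_expL_0 add.left_inverse)
  have lhs: "g \<otimes>\<^bsub>cw_G P \<nu>\<^esub> cw_section P \<nu> p =
    (((z + x0 + 1/2 * ((\<nu> * b) \<bullet> cw_A \<phi> x), cw_expL P \<nu> s (cvec b (c + cw_A \<phi> x))), s), \<phi>)"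
    by (simp add: g p cw_section_eq cw_G_mult cw_expL_K[OF \<phi>] a cw_omega_expL cw_K_cvec[OF \<phi>]
        cw_omega_cvec cvec_add flip: s_def cw_expL_add)
  have rhs: "cw_section P \<nu> q \<otimes>\<^bsub>cw_G P \<nu>\<^esub> (((0, cvec b' 0), 0), \<psi>) =
    (((y0 - 1/2 * ((\<nu> * b') \<bullet> y), cw_expL P \<nu> y1 (cvec b' y)), y1), \<psi>)" for b' \<psi>
    by (simp add: q cw_section_eq cw_G_mult cw_omega_expL cw_omega_cvec cvec_add inner_vec_mult[of \<nu> y] inner_commute[of y]
       flip: cw_expL_add)
  have "g \<otimes>\<^bsub>cw_G P \<nu>\<^esub> cw_section P \<nu> p \<in> cw_section P \<nu> q <#\<^bsub>cw_G P \<nu>\<^esub> cw_stabiliser P \<nu> \<longleftrightarrow>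
    (\<exists>b' \<psi>. \<psi> \<in> carrier (cw_K P \<nu>) \<and> g \<otimes>\<^bsub>cw_G P \<nu>\<^esub> cw_section P \<nu> p
       = cw_section P \<nu> q \<otimes>\<^bsub>cw_G P \<nu>\<^esub> (((0, cvec b' 0), 0), \<psi>))"
    by (auto simp: l_coset_def cw_stabiliser_eq)
  also have "\<dots> \<longleftrightarrow> y1 = s \<and> y = c + cw_A \<phi> x \<and> y0 = z + x0 + (\<nu> * b) \<bullet> cw_A \<phi> x + 1/2 * ((\<nu> * b) \<bullet> c)"
  proof -
    have "y0 - 1/2 * ((\<nu> * b) \<bullet> (c + cw_A \<phi> x)) = z + x0 + 1/2 * ((\<nu> * b) \<bullet> cw_A \<phi> x) \<longleftrightarrow>
      y0 = z + x0 + (\<nu> * b) \<bullet> cw_A \<phi> x + 1/2 * ((\<nu> * b) \<bullet> c)"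
      unfolding inner_add_right by (simp add: field_simps) argo
    then show ?thesis
      unfolding lhs rhs prod.inject using \<phi> by (metis inj cvec_eq_iff)
  qed
  also have "\<dots> \<longleftrightarrow> q = cw_map P \<nu> g p"
    unfolding cw_map_def g p q Let_def b_def c_def s_def by auto
  finally show ?thesis .
qed

lemma cw_act_eq: "g \<in> carrier (cw_G P \<nu>) \<Longrightarrow> cw_act P \<nu> g = cw_map P \<nu> g"
  by (rule ext) (simp add: cw_act_def cw_coset_iff)

text \<open>Argued on cosets: moving both elements past a section leaves two stabiliser elements,
  whose product is again in the stabiliser. This avoids composing the explicit formulas.\<close>

lemma cw_act_mult:
  assumes g: "g \<in> carrier (cw_G P \<nu>)" and h: "h \<in> carrier (cw_G P \<nu>)"
  shows "cw_act P \<nu> (g \<otimes>\<^bsub>cw_G P \<nu>\<^esub> h) p = cw_act P \<nu> g (cw_act P \<nu> h p)"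
proof -
  interpret group "cw_G P \<nu>" by (rule cw_G_group)
  have sec: "cw_section P \<nu> q \<in> carrier (cw_G P \<nu>)" for q
    using group.is_monoid[OF cw_K_group, THEN monoid.one_closed]
    by (cases q) (auto simp: cw_section_eq cw_G_carrier cw_K_def)
  have stab: "cw_stabiliser P \<nu> \<subseteq> carrier (cw_G P \<nu>)"
    by (auto simp: cw_stabiliser_eq cw_G_carrier)
  have stab_mult: "k \<otimes>\<^bsub>cw_G P \<nu>\<^esub> k' \<in> cw_stabiliser P \<nu>" if "k \<in> cw_stabiliser P \<nu>" "k' \<in> cw_stabiliser P \<nu>" for k k'
  proof -
    have "\<phi> o\<^sub>L \<psi> \<in> carrier (cw_K P \<nu>)" if "\<phi> \<in> carrier (cw_K P \<nu>)" "\<psi> \<in> carrier (cw_K P \<nu>)" for \<phi> \<psi>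
      using monoid.m_closed[OF group.is_monoid[OF cw_K_group] that] by (simp add: cw_K_def)
    then show ?thesis
      using that by (auto simp: cw_stabiliser_eq cw_G_mult cw_K_cvec cw_omega_cvec cvec_add)
  qed
  have act: "\<exists>k\<in>cw_stabiliser P \<nu>. g \<otimes>\<^bsub>cw_G P \<nu>\<^esub> cw_section P \<nu> p = cw_section P \<nu> (cw_act P \<nu> g p) \<otimes>\<^bsub>cw_G P \<nu>\<^esub> k"
    if "g \<in> carrier (cw_G P \<nu>)" for g p
    using cw_coset_iff[OF that, of p "cw_act P \<nu> g p"] that by (auto simp: cw_act_eq l_coset_def)
  obtain k where k: "k \<in> cw_stabiliser P \<nu>"
    "h \<otimes>\<^bsub>cw_G P \<nu>\<^esub> cw_section P \<nu> p = cw_section P \<nu> (cw_act P \<nu> h p) \<otimes>\<^bsub>cw_G P \<nu>\<^esub> k"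
    using act[OF h] by blast
  obtain k' where k': "k' \<in> cw_stabiliser P \<nu>"
    "g \<otimes>\<^bsub>cw_G P \<nu>\<^esub> cw_section P \<nu> (cw_act P \<nu> h p)
      = cw_section P \<nu> (cw_act P \<nu> g (cw_act P \<nu> h p)) \<otimes>\<^bsub>cw_G P \<nu>\<^esub> k'"
    using act[OF g] by blast
  have kc: "k \<in> carrier (cw_G P \<nu>)" "k' \<in> carrier (cw_G P \<nu>)"
    using k k' stab by auto
  have "(g \<otimes>\<^bsub>cw_G P \<nu>\<^esub> h) \<otimes>\<^bsub>cw_G P \<nu>\<^esub> cw_section P \<nu> p
    = (g \<otimes>\<^bsub>cw_G P \<nu>\<^esub> cw_section P \<nu> (cw_act P \<nu> h p)) \<otimes>\<^bsub>cw_G P \<nu>\<^esub> k"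
    using g h sec kc k(2) by (simp add: m_assoc)
  also have "\<dots> = cw_section P \<nu> (cw_act P \<nu> g (cw_act P \<nu> h p)) \<otimes>\<^bsub>cw_G P \<nu>\<^esub> (k' \<otimes>\<^bsub>cw_G P \<nu>\<^esub> k)"
    unfolding k'(2) using sec kc by (simp add: m_assoc)
  also have "\<dots> \<in> cw_section P \<nu> (cw_act P \<nu> g (cw_act P \<nu> h p)) <#\<^bsub>cw_G P \<nu>\<^esub> cw_stabiliser P \<nu>"
    using stab_mult[OF k'(1) k(1)] by (auto simp: l_coset_def)
  finally show ?thesis
    using cw_coset_iff[of "g \<otimes>\<^bsub>cw_G P \<nu>\<^esub> h"] g h by (simp add: cw_act_eq)
qed

lemma cw_act_one: "cw_act P \<nu> \<one>\<^bsub>cw_G P \<nu>\<^esub> p = p"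
proof -
  have "\<one>\<^bsub>cw_G P \<nu>\<^esub> \<in> carrier (cw_G P \<nu>)"
    using group.is_monoid[OF cw_G_group, THEN monoid.one_closed] .
  moreover have "cw_expL P \<nu> s 0 = 0" for s
    using cw_expL_add[of P \<nu> s 0 0] by simp
  ultimately show ?thesis
    by (cases p) (simp add: cw_act_eq cw_map_def cw_G_one vRe_def vIm_def vec_eq_iff zero_vec_def[symmetric])
qed

subsection \<open>Parallel transport in global coordinates\<close>

definition cw_q :: "'n::finite set \<Rightarrow> real^'n \<Rightarrow> 'n cw_point \<Rightarrow> real" where
  "cw_q P \<nu> = (\<lambda>(x0, x1, x). x \<bullet> (cw_sig P \<nu> * x))"

text \<open>In the frames given by \<open>(v\<^sub>0, v\<^sub>1, v) \<mapsto> (v\<^sub>0 - 1/2 q(p) v\<^sub>1, v\<^sub>1, v)\<close>, where the metric is the constant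
  \<open>2 v\<^sub>0 v\<^sub>1 + \<bar>v\<bar>\<^sup>2\<close>, the map below is \<open>A\<close> followed by the null rotation by \<open>w\<close>; the parameter \<open>c\<close> is
  the difference of \<open>q\<close> between the end point and the starting point.\<close>

definition cw_hol :: "real \<Rightarrow> real^'n \<Rightarrow> (real^'n \<Rightarrow> real^'n) \<Rightarrow> 'n::finite cw_point \<Rightarrow> 'n cw_point" where
  "cw_hol c w A = (\<lambda>(v0, v1, v). (v0 - A v \<bullet> w - 1/2 * (w \<bullet> w + c) * v1, v1, A v + v1 *\<^sub>R w))"

text \<open>The multiplication of a semidirect product: \<open>w'\<close> is transported by
  \<open>A\<close>. Orthogonality turns \<open>A' v \<bullet> w'\<close> into
  \<open>A (A' v) \<bullet> A w'\<close> and keeps the norm of \<open>w'\<close>, while the scalars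
  simply add.\<close>

lemma hol_compose:
  assumes "\<And>x y. A x \<bullet> A y = x \<bullet> y" and "linear A"
  shows "cw_hol c w A (cw_hol c' w' A' v) = cw_hol (c + c') (w + A w') (\<lambda>x. A (A' x)) v"
proof -
  obtain v0 v1 x where v: "v = (v0, v1, x)" by (metis surj_pair)
  show ?thesis
    using assms by (simp add: cw_hol_def v linear_add linear_scale algebra_simps inner_simps inner_commute add_divide_distrib)
qed

lemma hol_id [simp]: "cw_hol 0 0 (\<lambda>x. x) v = v"
  by (cases v) (simp add: cw_hol_def)

lemma bounded_linear_hol:
  assumes "bounded_linear A"
  shows "bounded_linear (cw_hol c w A)"
proof -
  interpret A: bounded_linear A by fact
  show ?thesis
    unfolding linear_conv_bounded_linear[symmetric]
    by (rule linearI) (auto simp: cw_hol_def A.add A.scale algebra_simps inner_simps add_divide_distrib split: prod.splits)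
qed

section \<open>The Levi-Civita connection and its parallel fields\<close>

lemma cw_metric_eq:
  "cw_metric P \<nu> p (v0, v1, v) (w0, w1, w) = v0 * w1 + v1 * w0 + v \<bullet> w + cw_q P \<nu> p * (v1 * w1)"
proof -
  obtain x0 x1 x where p: "p = (x0, x1, x)" by (metis surj_pair)
  have "(\<Sum>i\<in>UNIV. x $ i * (cw_sig P \<nu> * x) $ i)
    = (\<Sum>i\<in>P. x $ i * (cw_sig P \<nu> * x) $ i) + (\<Sum>i\<in>-P. x $ i * (cw_sig P \<nu> * x) $ i)"
    by (subst sum.union_disjoint[symmetric]) auto
  also have "(\<Sum>i\<in>P. x $ i * (cw_sig P \<nu> * x) $ i) = (\<Sum>i\<in>P. (\<nu> $ i)\<^sup>2 * (x $ i)\<^sup>2)"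
    by (rule sum.cong) (auto simp: cw_sig_def cw_eps_def power2_eq_square)
  also have "(\<Sum>i\<in>-P. x $ i * (cw_sig P \<nu> * x) $ i) = - (\<Sum>i\<in>-P. (\<nu> $ i)\<^sup>2 * (x $ i)\<^sup>2)"
    unfolding sum_negf[symmetric] by (rule sum.cong) (auto simp: cw_sig_def cw_eps_def power2_eq_square)
  finally show ?thesis
    by (simp add: cw_metric_def cw_q_def p inner_vec_def)
qed

lemma bounded_linear_vec_mult: "bounded_linear (\<lambda>x::real^'n. y * x)"
  unfolding linear_conv_bounded_linear[symmetric]
  by (rule linearI) (auto simp: algebra_simps vec_eq_iff)

lemma vec_mult_scaleR: "y * (r *\<^sub>R x) = r *\<^sub>R (y * (x::real^'n))"
  by (simp add: vec_eq_iff)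

lemma cw_q_has_derivative:
  fixes p :: "'n::finite cw_point"
  shows "(cw_q P \<nu> has_derivative (\<lambda>(u0, u1, u). 2 * ((cw_sig P \<nu> * snd (snd p)) \<bullet> u))) (at p within X)"
proof -
  have "cw_q P \<nu> = (\<lambda>p. snd (snd p) \<bullet> (cw_sig P \<nu> * snd (snd p)))"
    by (auto simp: cw_q_def)
  moreover have "((\<lambda>p. snd (snd p) \<bullet> (cw_sig P \<nu> * snd (snd p))) has_derivative
      (\<lambda>u. snd (snd p) \<bullet> (cw_sig P \<nu> * snd (snd u)) + snd (snd u) \<bullet> (cw_sig P \<nu> * snd (snd p)))) (at p within X)"
    by (intro has_derivative_inner bounded_linear.has_derivative[OF bounded_linear_vec_mult]
        has_derivative_snd has_derivative_ident)
  moreover have "(\<lambda>u :: 'n cw_point. snd (snd p) \<bullet> (cw_sig P \<nu> * snd (snd u)) + snd (snd u) \<bullet> (cw_sig P \<nu> * snd (snd p)))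
    = (\<lambda>(u0, u1, u). 2 * ((cw_sig P \<nu> * snd (snd p)) \<bullet> u))"
    by (auto simp: fun_eq_iff inner_vec_def mult_ac)
  ultimately show ?thesis
    by (simp only:)
qed

text \<open>Only the coefficient of \<open>dz'^2\<close> varies, and only with \<open>x\<close>, so
  every derivative of the metric comes from \<open>cw_q\<close>.\<close>

lemma cw_christoffel:
  "christoffel (cw_metric P \<nu>) p (u0, u1, u) (v0, v1, v)
    = ((cw_sig P \<nu> * snd (snd p)) \<bullet> (v1 *\<^sub>R u + u1 *\<^sub>R v), 0, - (u1 * v1) *\<^sub>R (cw_sig P \<nu> * snd (snd p)))"
proof -
  let ?D = "cw_sig P \<nu> * snd (snd p)"
  have fd: "frechet_derivative (\<lambda>p. cw_metric P \<nu> p (v0, v1, v) (w0, w1, w)) (at p) (u0, u1, u)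
     = 2 * (?D \<bullet> u) * (v1 * w1)" for v0 v1 v w0 w1 w u0 u1 u
  proof -
    have "((\<lambda>p. cw_metric P \<nu> p (v0, v1, v) (w0, w1, w)) has_derivative
      (\<lambda>(u0, u1, u). 2 * (?D \<bullet> u) * (v1 * w1))) (at p)"
      unfolding cw_metric_eq by (auto intro!: derivative_eq_intros cw_q_has_derivative simp: fun_eq_iff)
    from frechet_derivative_at[OF this] show ?thesis
      by (metis (mono_tags, lifting) case_prod_conv)
  qed
  let ?y = "(?D \<bullet> (v1 *\<^sub>R u + u1 *\<^sub>R v), 0, - (u1 * v1) *\<^sub>R ?D)"
  let ?Q = "\<lambda>y. \<forall>w. cw_metric P \<nu> p y w = 1/2 *
     ( frechet_derivative (\<lambda>p. cw_metric P \<nu> p (v0, v1, v) w) (at p) (u0, u1, u)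
     + frechet_derivative (\<lambda>p. cw_metric P \<nu> p (u0, u1, u) w) (at p) (v0, v1, v)
     - frechet_derivative (\<lambda>p. cw_metric P \<nu> p (u0, u1, u) (v0, v1, v)) (at p) w)"
  have y: "?Q ?y"
    by (auto simp: fd) (simp add: cw_metric_eq inner_simps algebra_simps)
  have "z = ?y" if "?Q z" for z
  proof -
    have eq: "cw_metric P \<nu> p z w = cw_metric P \<nu> p ?y w" for w
      using spec[OF that, of w] spec[OF y, of w] by (rule trans[OF _ sym])
    obtain z0 z1 x where z: "z = (z0, z1, x)" by (metis surj_pair)
    \<comment> \<open>Nondegeneracy by test vectors: the null vector \<open>(1, 0, 0)\<close> reads
      off \<open>z1\<close>, and once this vanishes, \<open>(0, 1, 0)\<close> reads off
      \<open>z0\<close>.\<close>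
    have 1: "z1 = 0"
      using eq[of "(1, 0, 0)"] by (simp add: z cw_metric_eq)
    moreover have 0: "z0 = ?D \<bullet> (v1 *\<^sub>R u + u1 *\<^sub>R v)"
      using eq[of "(0, 1, 0)"] 1 by (simp add: z cw_metric_eq)
    moreover have "x = - (u1 * v1) *\<^sub>R ?D"
    proof -
      have "x \<bullet> w = (- (u1 * v1) *\<^sub>R ?D) \<bullet> w" for w
        using eq[of "(0, 0, w)"] by (simp add: z cw_metric_eq)
      then show ?thesis
        by (metis vector_eq_rdot)
    qed
    ultimately show ?thesis by (simp add: z)
  qed
  with y show ?thesis
    unfolding christoffel_def by (intro the_equality) blast+
qed

lemma has_vector_derivative_unique_from:
  fixes f g :: "real \<Rightarrow> 'a::real_normed_vector"
  assumes "\<And>r. r \<in> {s..t} \<Longrightarrow> (f has_vector_derivative f' r) (at r within {s..t})"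
    and "\<And>r. r \<in> {s..t} \<Longrightarrow> (g has_vector_derivative f' r) (at r within {s..t})"
    and "f s = g s" and "r \<in> {s..t}"
  shows "f r = g r"
proof -
  have "((\<lambda>r. f r - g r) has_vector_derivative 0) (at r within {s..t})" if "r \<in> {s..t}" for r
    using has_vector_derivative_diff[OF assms(1,2)[OF that]] by simp
  then obtain c where "\<And>r. r \<in> {s..t} \<Longrightarrow> f r - g r = c"
    using has_vector_derivative_zero_constant[of "{s..t}" "\<lambda>r. f r - g r"] by auto
  from this[of r] this[of s] show ?thesis
    using assms(3,4) by auto
qed

text \<open>The derivative of \<open>W\<close> accounts for the Christoffel terms containing the
  velocity \<open>u1\<close>. The derivative of \<open>cw_q\<close> along the curve supplies the
  remaining term \<open>(D \<bullet> u) * v1\<close> in the first component.\<close>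

lemma cw_parallel_hol:
  assumes x: "\<And>r. r \<in> I \<Longrightarrow> (x has_vector_derivative x' r) (at r within I)"
    and W: "\<And>r. r \<in> I \<Longrightarrow> (W has_vector_derivative fst (snd (x' r)) *\<^sub>R (cw_sig P \<nu> * snd (snd (x r)))) (at r within I)"
  shows "parallel_on (cw_metric P \<nu>) I x x' (\<lambda>r. cw_hol (cw_q P \<nu> (x r) - c) (W r) (\<lambda>x. x) v)"
  unfolding parallel_on_def
proof
  fix r assume r: "r \<in> I"
  obtain v0 v1 v2 where v: "v = (v0, v1, v2)" by (metis surj_pair)
  obtain u0 u1 u where u: "x' r = (u0, u1, u)" by (metis surj_pair)
  let ?D = "cw_sig P \<nu> * snd (snd (x r))"
  have q: "((\<lambda>r. cw_q P \<nu> (x r)) has_vector_derivative 2 * (?D \<bullet> u)) (at r within I)"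
    using has_derivative_compose[OF x[OF r, unfolded has_vector_derivative_def] cw_q_has_derivative]
    by (simp add: has_vector_derivative_def u mult_ac scaleR_prod_def)
  have W': "(W has_vector_derivative u1 *\<^sub>R ?D) (at r within I)"
    using W[OF r] by (simp add: u)
  have "((\<lambda>r. (v0 - v2 \<bullet> W r - 1/2 * (W r \<bullet> W r + (cw_q P \<nu> (x r) - c)) * v1, v1, v2 + v1 *\<^sub>R W r))
    has_vector_derivative (- (v2 \<bullet> (u1 *\<^sub>R ?D)) - 1/2 * (2 * (W r \<bullet> (u1 *\<^sub>R ?D)) + 2 * (?D \<bullet> u)) * v1, 0, v1 *\<^sub>R u1 *\<^sub>R ?D)) (at r within I)"
    using W' q unfolding has_vector_derivative_def
    by (auto intro!: derivative_eq_intros simp: fun_eq_iff algebra_simps inner_commute)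
  then show "((\<lambda>r. cw_hol (cw_q P \<nu> (x r) - c) (W r) (\<lambda>x. x) v) has_vector_derivative
          - christoffel (cw_metric P \<nu>) (x r) (x' r) (cw_hol (cw_q P \<nu> (x r) - c) (W r) (\<lambda>x. x) v)) (at r within I)"
    by (simp add: cw_hol_def v u cw_christoffel inner_simps algebra_simps inner_commute)
qed

text \<open>The equation is triangular: the middle component is constant, the vector component has a
  derivative determined by the middle one, and the first a derivative determined by the other two.
  Equality thus propagates component by component, each time because two functions share derivative
  and initial value.\<close>

lemma cw_parallel_unique:
  assumes V: "parallel_on (cw_metric P \<nu>) {s..t} x x' V"
    and U: "parallel_on (cw_metric P \<nu>) {s..t} x x' U"
    and s: "V s = U s" and r: "r \<in> {s..t}"
  shows "V r = U r"
proof -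
  define D where "D r = cw_sig P \<nu> * snd (snd (x r))" for r
  have comp: "((\<lambda>r. fst (V r)) has_vector_derivative
      - (D r \<bullet> (fst (snd (V r)) *\<^sub>R snd (snd (x' r)) + fst (snd (x' r)) *\<^sub>R snd (snd (V r))))) (at r within {s..t})
    \<and> ((\<lambda>r. fst (snd (V r))) has_vector_derivative 0) (at r within {s..t})
    \<and> ((\<lambda>r. snd (snd (V r))) has_vector_derivative (fst (snd (x' r)) * fst (snd (V r))) *\<^sub>R D r) (at r within {s..t})"
    if "parallel_on (cw_metric P \<nu>) {s..t} x x' V" "r \<in> {s..t}" for V r
  proof -
    obtain u0 u1 u v0 v1 v where u: "x' r = (u0, u1, u)" and v: "V r = (v0, v1, v)"
      by (metis surj_pair)
    have V: "(V has_vector_derivative - christoffel (cw_metric P \<nu>) (x r) (x' r) (V r)) (at r within {s..t})"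
      using that by (auto simp: parallel_on_def)
    from bounded_linear.has_vector_derivative[OF bounded_linear_fst V]
      bounded_linear.has_vector_derivative[OF bounded_linear_fst bounded_linear.has_vector_derivative[OF bounded_linear_snd V]]
      bounded_linear.has_vector_derivative[OF bounded_linear_snd bounded_linear.has_vector_derivative[OF bounded_linear_snd V]]
    show ?thesis
      by (simp add: u v cw_christoffel D_def)
  qed
  note V' = comp[OF V] and U' = comp[OF U]
  have 1: "fst (snd (V r)) = fst (snd (U r))" if r: "r \<in> {s..t}" for r
    by (rule has_vector_derivative_unique_from[where f="\<lambda>r. fst (snd (V r))" and g="\<lambda>r. fst (snd (U r))",
          OF V'[THEN conjunct2, THEN conjunct1] U'[THEN conjunct2, THEN conjunct1] _ r])
       (simp_all add: s)
  have 2: "snd (snd (V r)) = snd (snd (U r))" if r: "r \<in> {s..t}" for r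
    by (rule has_vector_derivative_unique_from[where f="\<lambda>r. snd (snd (V r))" and g="\<lambda>r. snd (snd (U r))",
          OF V'[THEN conjunct2, THEN conjunct2] _ _ r])
       (use U'[THEN conjunct2, THEN conjunct2] in \<open>simp_all add: s 1\<close>)
  have 0: "fst (V r) = fst (U r)"
    by (rule has_vector_derivative_unique_from[where f="\<lambda>r. fst (V r)" and g="\<lambda>r. fst (U r)",
          OF V'[THEN conjunct1] _ _ r])
       (use U'[THEN conjunct1] in \<open>simp_all add: s 1 2\<close>)
  show ?thesis
    using 0 1[OF r] 2[OF r] by (simp add: prod_eq_iff)
qed

text \<open>The vector \<open>b + \<i> c\<close> is the value of an orbit of the flow of
  \<open>- L\<close>, so the derivatives of \<open>b\<close> and \<open>c\<close> are
  \<open>- (eps \<nu> c)\<close> and \<open>- (\<nu> b)\<close>. Inserting them gives a differential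
  of the same shape as a parallel transport, with \<open>w\<close> depending on the point.\<close>

lemma cw_act_has_derivative:
  assumes "g \<in> carrier (cw_G P \<nu>)"
  shows "\<exists>w. (cw_act P \<nu> g has_derivative cw_hol (cw_q P \<nu> (cw_act P \<nu> g p) - cw_q P \<nu> p) w (cw_A (snd g))) (at p)"
proof -
  obtain z a t \<phi> where g: "g = (((z, a), t), \<phi>)"
    by (metis surj_pair)
  obtain x0 x1 x where p: "p = (x0, x1, x)"
    by (metis surj_pair)
  have \<phi>: "\<phi> \<in> carrier (cw_K P \<nu>)"
    using assms by (simp add: g cw_G_carrier)
  define b c where "b s = vRe (cw_expL P \<nu> (- (t + s)) a)" and "c s = vIm (cw_expL P \<nu> (- (t + s)) a)" for s
  have b_eq: "b s = cw_C P \<nu> (- (t + s)) * vRe a + cw_eps P * cw_S P \<nu> (- (t + s)) * vIm a"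
    and c_eq: "c s = cw_C P \<nu> (- (t + s)) * vIm a + cw_S P \<nu> (- (t + s)) * vRe a" for s
    using cw_expL_cvec[of P \<nu> "- (t + s)" "vRe a" "vIm a"] by (simp_all add: b_def c_def)
  have neg: "((\<lambda>s. - (t + s)) has_real_derivative - 1) (at s)" for s
    by (auto intro!: derivative_eq_intros)
  have C': "((\<lambda>s. cw_C P \<nu> (- (t + s))) has_vector_derivative - (cw_eps P * \<nu> * cw_S P \<nu> (- (t + s)))) (at s)"
    and S': "((\<lambda>s. cw_S P \<nu> (- (t + s))) has_vector_derivative - (\<nu> * cw_C P \<nu> (- (t + s)))) (at s)" for s
    using vector_diff_chain_at[OF neg[unfolded has_real_derivative_iff_has_vector_derivative] cw_C_deriv]
      vector_diff_chain_at[OF neg[unfolded has_real_derivative_iff_has_vector_derivative] cw_S_deriv]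
    by (simp_all add: o_def)
  have mult': "((\<lambda>s. f s * y) has_vector_derivative f' * y) F" if "(f has_vector_derivative f') F"
    for f :: "real \<Rightarrow> real^'a" and f' y F
    using bounded_linear.has_vector_derivative[OF bounded_linear_vec_mult[of y] that]
    by (simp add: mult.commute)
  have b': "(b has_vector_derivative - (cw_eps P * \<nu> * c s)) (at s)" for s
    unfolding b_eq[abs_def] c_eq
    using has_vector_derivative_add[OF mult'[OF C', of "vRe a"] mult'[OF mult'[OF S', of "cw_eps P"], of "vIm a"]]
    by (simp add: algebra_simps)
  have c': "(c has_vector_derivative - (\<nu> * b s)) (at s)" for s
    unfolding c_eq[abs_def] b_eq
    using has_vector_derivative_add[OF mult'[OF C', of "vIm a"] mult'[OF S', of "vRe a"]]
    by (simp add: algebra_simps)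
  have act: "cw_act P \<nu> g = (\<lambda>p. (z + fst p + (\<nu> * b (fst (snd p))) \<bullet> cw_A \<phi> (snd (snd p))
      + 1/2 * ((\<nu> * b (fst (snd p))) \<bullet> c (fst (snd p))), t + fst (snd p), c (fst (snd p)) + cw_A \<phi> (snd (snd p))))"
    unfolding cw_act_eq[OF assms] by (rule ext) (simp add: cw_map_def g Let_def b_def c_def split: prod.splits)
  have s: "((\<lambda>p. fst (snd p)) has_derivative (\<lambda>v. fst (snd v))) (at (x0, x1, x))"
    by (auto intro!: derivative_eq_intros)
  have bd: "((\<lambda>p. b (fst (snd p))) has_derivative (\<lambda>v. fst (snd v) *\<^sub>R - (cw_eps P * \<nu> * c x1))) (at (x0, x1, x))"
    and cd: "((\<lambda>p. c (fst (snd p))) has_derivative (\<lambda>v. fst (snd v) *\<^sub>R - (\<nu> * b x1))) (at (x0, x1, x))"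
    using has_derivative_compose[OF s, of b] has_derivative_compose[OF s, of c] b'[of x1] c'[of x1]
    by (simp_all add: has_vector_derivative_def)
  have Ad: "((\<lambda>p. cw_A \<phi> (snd (snd p))) has_derivative (\<lambda>v. cw_A \<phi> (snd (snd v)))) (at (x0, x1, x))"
    by (auto intro!: bounded_linear.has_derivative[OF bounded_linear_cw_A] derivative_eq_intros)
  have nbd: "((\<lambda>p. \<nu> * b (fst (snd p))) has_derivative (\<lambda>v. fst (snd v) *\<^sub>R - (cw_sig P \<nu> * c x1))) (at (x0, x1, x))"
    using bounded_linear.has_derivative[OF bounded_linear_vec_mult[of \<nu>] bd]
    by (simp add: vec_mult_scaleR cw_sig_def mult_ac)
  have "(cw_act P \<nu> g has_derivative (\<lambda>v. (
      fst v + (fst (snd v) *\<^sub>R - (cw_sig P \<nu> * c x1)) \<bullet> cw_A \<phi> x + (\<nu> * b x1) \<bullet> cw_A \<phi> (snd (snd v))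
      + 1/2 * ((fst (snd v) *\<^sub>R - (cw_sig P \<nu> * c x1)) \<bullet> c x1 + (\<nu> * b x1) \<bullet> (fst (snd v) *\<^sub>R - (\<nu> * b x1))),
      fst (snd v), fst (snd v) *\<^sub>R - (\<nu> * b x1) + cw_A \<phi> (snd (snd v))))) (at (x0, x1, x))"
    unfolding act
    by (rule has_derivative_eq_rhs, (rule derivative_intros nbd cd Ad)+) (auto simp: fun_eq_iff field_simps)
  \<comment> \<open>The map \<open>cw_A \<phi>\<close> preserves the quadratic form, so only the
    terms involving the shift by \<open>c\<close> remain.\<close>
  moreover have "cw_q P \<nu> (cw_act P \<nu> g p) - cw_q P \<nu> p
    = 2 * ((cw_sig P \<nu> * c x1) \<bullet> cw_A \<phi> x) + (cw_sig P \<nu> * c x1) \<bullet> c x1"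
  proof -
    have "cw_A \<phi> x \<bullet> (cw_sig P \<nu> * cw_A \<phi> x) = x \<bullet> (cw_sig P \<nu> * x)"
      by (simp add: cw_A_inner[OF \<phi>] flip: cw_A_sig[OF \<phi>])
    moreover have "cw_A \<phi> x \<bullet> (cw_sig P \<nu> * c x1) = c x1 \<bullet> (cw_sig P \<nu> * cw_A \<phi> x)"
      by (simp add: inner_vec_def mult_ac)
    ultimately show ?thesis
      by (simp add: act p cw_q_def distrib_left inner_simps inner_commute)
  qed
  \<comment> \<open>The vector \<open>w\<close> is the derivative of the shift \<open>c\<close> with
    respect to \<open>x1\<close>.\<close>
  ultimately show ?thesis
    unfolding p g
    by (intro exI[of _ "- (\<nu> * b x1)"])
       (auto simp: cw_hol_def fun_eq_iff algebra_simps inner_simps inner_commute elim!: back_subst[where P="\<lambda>f. (_ has_derivative f) _"])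
qed

subsection \<open>Transport in the quotient\<close>

lemma cw_quotient_eq:
  "\<kappa> \<in> cw_quotient P \<nu> \<Gamma> \<longleftrightarrow>
    open (dom \<kappa>) \<and> inj_on (cw_orbit P \<nu> \<Gamma>) (dom \<kappa>) \<and> par \<kappa> = cw_orbit P \<nu> \<Gamma> \<and> met \<kappa> = cw_metric P \<nu>"
  by (cases \<kappa>) (auto simp: cw_quotient_def quotient_manifold_def)

lemma cw_act_continuous:
  assumes "g \<in> carrier (cw_G P \<nu>)"
  shows "continuous_on X (cw_act P \<nu> g)"
  using cw_act_has_derivative[OF assms]
  by (meson continuous_at_imp_continuous_on has_derivative_continuous)

locale cw_subgroup =
  fixes P :: "'n::finite set" and \<nu> :: "real^'n" and \<Gamma> :: "('n cw_transvection \<times> 'n cw_end) set"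
  assumes subgroup: "subgroup \<Gamma> (cw_G P \<nu>)"
begin

abbreviation "orb \<equiv> cw_orbit P \<nu> \<Gamma>"

abbreviation "M \<equiv> cw_quotient P \<nu> \<Gamma>"

lemma Gamma_carrier: "\<gamma> \<in> \<Gamma> \<Longrightarrow> \<gamma> \<in> carrier (cw_G P \<nu>)"
  using subgroup.subset[OF subgroup] by blast

lemma snd_Gamma: "\<gamma> \<in> \<Gamma> \<Longrightarrow> snd \<gamma> \<in> carrier (cw_K P \<nu>)"
  using Gamma_carrier[of \<gamma>] by (cases \<gamma>) (simp add: cw_G_carrier)

lemma Gamma_mult: "\<gamma> \<in> \<Gamma> \<Longrightarrow> \<gamma>' \<in> \<Gamma> \<Longrightarrow> \<gamma> \<otimes>\<^bsub>cw_G P \<nu>\<^esub> \<gamma>' \<in> \<Gamma>"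
  by (rule subgroup.m_closed[OF subgroup])

lemma Gamma_one: "\<one>\<^bsub>cw_G P \<nu>\<^esub> \<in> \<Gamma>"
  by (rule subgroup.one_closed[OF subgroup])

lemma Gamma_inverse:
  assumes "\<gamma> \<in> \<Gamma>"
  obtains \<gamma>' where "\<gamma>' \<in> \<Gamma>" "\<gamma>' \<otimes>\<^bsub>cw_G P \<nu>\<^esub> \<gamma> = \<one>\<^bsub>cw_G P \<nu>\<^esub>"
    "\<gamma> \<otimes>\<^bsub>cw_G P \<nu>\<^esub> \<gamma>' = \<one>\<^bsub>cw_G P \<nu>\<^esub>"
  using subgroup.m_inv_closed[OF subgroup assms] group.l_inv[OF cw_G_group Gamma_carrier[OF assms]]
    group.r_inv[OF cw_G_group Gamma_carrier[OF assms]] by blast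

lemma snd_mult: "snd (g \<otimes>\<^bsub>cw_G P \<nu>\<^esub> h) = snd g o\<^sub>L snd h"
  by (metis cw_G_mult prod.collapse snd_conv)

lemma snd_Gamma_compose: "\<phi> \<in> snd ` \<Gamma> \<Longrightarrow> \<psi> \<in> snd ` \<Gamma> \<Longrightarrow> \<phi> o\<^sub>L \<psi> \<in> snd ` \<Gamma>"
  using Gamma_mult snd_mult by (metis (no_types, lifting) image_iff)

lemma snd_Gamma_id: "id_blinfun \<in> snd ` \<Gamma>"
  using imageI[OF Gamma_one, of snd] by (simp add: cw_G_one)

lemma orb_eq_iff: "orb p = orb q \<longleftrightarrow> (\<exists>\<gamma>\<in>\<Gamma>. q = cw_act P \<nu> \<gamma> p)"
proof
  have "q \<in> orb q"
    using Gamma_one cw_act_one[of P \<nu> q] by (force simp: cw_orbit_def)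
  moreover assume "orb p = orb q"
  ultimately show "\<exists>\<gamma>\<in>\<Gamma>. q = cw_act P \<nu> \<gamma> p"
    by (auto simp: cw_orbit_def)
next
  have sub: "orb (cw_act P \<nu> \<gamma> p) \<subseteq> orb p" if "\<gamma> \<in> \<Gamma>" for \<gamma> p
  proof -
    have "cw_act P \<nu> \<gamma>' (cw_act P \<nu> \<gamma> p) = cw_act P \<nu> (\<gamma>' \<otimes>\<^bsub>cw_G P \<nu>\<^esub> \<gamma>) p" if "\<gamma>' \<in> \<Gamma>" for \<gamma>'
      using cw_act_mult[OF Gamma_carrier Gamma_carrier] that \<open>\<gamma> \<in> \<Gamma>\<close> by simp
    then show ?thesis
      using Gamma_mult[OF _ that] unfolding cw_orbit_def by blast
  qed
  assume "\<exists>\<gamma>\<in>\<Gamma>. q = cw_act P \<nu> \<gamma> p"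
  then obtain \<gamma> where \<gamma>: "\<gamma> \<in> \<Gamma>" "q = cw_act P \<nu> \<gamma> p" by blast
  obtain \<gamma>' where \<gamma>': "\<gamma>' \<in> \<Gamma>" "\<gamma>' \<otimes>\<^bsub>cw_G P \<nu>\<^esub> \<gamma> = \<one>\<^bsub>cw_G P \<nu>\<^esub>"
    by (rule Gamma_inverse[OF \<gamma>(1)])
  have "p = cw_act P \<nu> \<gamma>' q"
    using \<gamma> \<gamma>' cw_act_mult[OF Gamma_carrier Gamma_carrier] cw_act_one by metis
  then show "orb p = orb q"
    using sub[OF \<gamma>(1), of p] sub[OF \<gamma>'(1), of q] \<gamma>(2) by simp
qed

text \<open>Near \<open>u\<close> the transition map is \<gamma> itself: the orbit map is injective
  on \<open>U\<close>, so its inverse there must pick the point \<gamma> p of the orbit of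
  \<open>p\<close>.\<close>

lemma transition_has_derivative:
  assumes \<gamma>: "\<gamma> \<in> \<Gamma>" and U: "open U" "inj_on orb U" and u: "cw_act P \<nu> \<gamma> u \<in> U"
    and D: "(cw_act P \<nu> \<gamma> has_derivative D) (at u)"
  shows "((inv_into U orb \<circ> orb) has_derivative D) (at u)"
proof (rule has_derivative_transform_within_open[OF D])
  show "open (cw_act P \<nu> \<gamma> -` U)"
    using U(1) cw_act_continuous[OF Gamma_carrier[OF \<gamma>]] by (rule open_vimage)
  show "u \<in> cw_act P \<nu> \<gamma> -` U"
    using u by simp
  show "cw_act P \<nu> \<gamma> p = (inv_into U orb \<circ> orb) p" if "p \<in> cw_act P \<nu> \<gamma> -` U" for p
  proof -
    have "orb p = orb (cw_act P \<nu> \<gamma> p)"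
      using orb_eq_iff \<gamma> by blast
    then show ?thesis
      using that U(2) by simp
  qed
qed

text \<open>The invariant quantifies over every lift of the starting point, so that the lift reached
  by one transport can be fed to the next. No lift of the whole curve is built. A piece contributes
  the identity of \<open>K\<close>, a change of chart the \<open>K\<close>-component of the group
  element relating the two lifts.\<close>

lemma par_transport_hol:
  assumes "par_transport M c a b T"
  shows "\<forall>u\<in>dom (fst a). par (fst a) u = c (snd a) \<longrightarrow>
    (\<exists>u'\<in>dom (fst b). par (fst b) u' = c (snd b) \<and>
      (\<exists>w. \<exists>\<phi>\<in>snd ` \<Gamma>. blinfun_apply T = cw_hol (cw_q P \<nu> u' - cw_q P \<nu> u) w (cw_A \<phi>)))"
  using assms
proof (induction rule: par_transport.induct)
  case (piece \<kappa> s t x x' T)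
  let ?I = "{s..t}"
  have \<kappa>: "inj_on orb (dom \<kappa>)" "par \<kappa> = orb" "met \<kappa> = cw_metric P \<nu>"
    using piece(1) by (auto simp: cw_quotient_eq)
  let ?f = "\<lambda>r. fst (snd (x' r)) *\<^sub>R (cw_sig P \<nu> * snd (snd (x r)))"
  define W where "W r = integral {s..r} ?f" for r
  have x: "(x has_vector_derivative x' r) (at r within ?I)" if "r \<in> ?I" for r
    using piece(4) that by (auto simp: C1_curve_on_def)
  have cont: "continuous_on ?I x" "continuous_on ?I x'"
    unfolding continuous_on_eq_continuous_within
    using x piece(4) has_vector_derivative_continuous
    by (blast, simp add: C1_curve_on_def continuous_on_eq_continuous_within)
  have "continuous_on ?I ?f"
    by (intro continuous_intros cont bounded_linear.continuous_on[OF bounded_linear_vec_mult])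
  then have W: "(W has_vector_derivative ?f r) (at r within ?I)" if "r \<in> ?I" for r
    using integral_has_vector_derivative that unfolding W_def by blast
  have W0: "W s = 0"
    by (simp add: W_def)
  \<comment> \<open>The rule supplies some parallel field from \<open>v\<close> to
    \<open>T v\<close>; uniqueness identifies it with the explicit one, which starts at
    \<open>v\<close> because \<open>W s = 0\<close>.\<close>
  have "T v = cw_hol (cw_q P \<nu> (x t) - cw_q P \<nu> (x s)) (W t) (cw_A id_blinfun) v" for v
  proof -
    obtain V where V: "parallel_on (cw_metric P \<nu>) ?I x x' V" "V s = v" "V t = T v"
      using spec[OF piece(5), of v] unfolding \<kappa> by blast
    show ?thesis
      using cw_parallel_unique[OF V(1) cw_parallel_hol[OF x W, of "cw_q P \<nu> (x s)" v], of t] V W0 piece(2)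
      by (simp add: cw_hol_def)
  qed
  then have T: "blinfun_apply T = cw_hol (cw_q P \<nu> (x t) - cw_q P \<nu> (x s)) (W t) (cw_A id_blinfun)"
    by blast
  show ?case
  proof (intro ballI impI)
    fix u assume "u \<in> dom (fst (\<kappa>, s))" "par (fst (\<kappa>, s)) u = c (snd (\<kappa>, s))"
    then have "u = x s"
      using bspec[OF piece(3), of s] piece(2) \<kappa> by (intro inj_onD[OF \<kappa>(1)]) auto
    then show "\<exists>u'\<in>dom (fst (\<kappa>, t)). par (fst (\<kappa>, t)) u' = c (snd (\<kappa>, t)) \<and>
      (\<exists>w. \<exists>\<phi>\<in>snd ` \<Gamma>. blinfun_apply T = cw_hol (cw_q P \<nu> u' - cw_q P \<nu> u) w (cw_A \<phi>))"
      using bspec[OF piece(3), of t] piece(2)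
      by (intro bexI[of _ "x t"] conjI exI[of _ "W t"] bexI[OF _ snd_Gamma_id]) (simp_all add: T)
  qed
next
  case (change \<kappa> \<kappa>' u t T)
  have \<kappa>: "inj_on orb (dom \<kappa>)" "par \<kappa> = orb" and \<kappa>': "open (dom \<kappa>')" "inj_on orb (dom \<kappa>')" "par \<kappa>' = orb"
    using change(1,2) by (auto simp: cw_quotient_eq)
  obtain u' where u': "u' \<in> dom \<kappa>'" "orb u' = c t"
    using change(5) \<kappa>' by auto
  then obtain \<gamma> where \<gamma>: "\<gamma> \<in> \<Gamma>" "u' = cw_act P \<nu> \<gamma> u"
    using change(4) \<kappa> orb_eq_iff by (metis (no_types))
  obtain w where w: "(cw_act P \<nu> \<gamma> has_derivative cw_hol (cw_q P \<nu> u' - cw_q P \<nu> u) w (cw_A (snd \<gamma>))) (at u)"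
    using cw_act_has_derivative[OF Gamma_carrier[OF \<gamma>(1)]] \<gamma>(2) by blast
  have "blinfun_apply T = cw_hol (cw_q P \<nu> u' - cw_q P \<nu> u) w (cw_A (snd \<gamma>))"
    using change(6) transition_has_derivative[OF \<gamma>(1) \<kappa>'(1,2) _ w] u' \<gamma>(2) \<kappa> \<kappa>'
    by (auto intro: has_derivative_unique)
  moreover have "v = u" if "v \<in> dom \<kappa>" "par \<kappa> v = c t" for v
    using that change(3,4) \<kappa> by (intro inj_onD[OF \<kappa>(1)]) auto
  ultimately show ?case
    using u' \<gamma> \<kappa>' by force
next
  case (concat a b T d T')
  show ?case
  proof (intro ballI impI)
    fix u assume "u \<in> dom (fst a)" "par (fst a) u = c (snd a)"
    then obtain u' w \<phi> where u': "u' \<in> dom (fst b)" "par (fst b) u' = c (snd b)" "\<phi> \<in> snd ` \<Gamma>"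
      "blinfun_apply T = cw_hol (cw_q P \<nu> u' - cw_q P \<nu> u) w (cw_A \<phi>)"
      using concat.IH(1) by blast
    then obtain u'' w' \<phi>' where u'': "u'' \<in> dom (fst d)" "par (fst d) u'' = c (snd d)" "\<phi>' \<in> snd ` \<Gamma>"
      "blinfun_apply T' = cw_hol (cw_q P \<nu> u'' - cw_q P \<nu> u') w' (cw_A \<phi>')"
      using concat.IH(2) by blast
    have K: "\<phi> \<in> carrier (cw_K P \<nu>)" "\<phi>' \<in> carrier (cw_K P \<nu>)"
      using u'(3) u''(3) snd_Gamma by auto
    have A: "cw_A (\<phi>' o\<^sub>L \<phi>) = (\<lambda>x. cw_A \<phi>' (cw_A \<phi> x))"
      by (rule ext) (rule cw_A_compose[OF K(1)])
    have "blinfun_apply (T' o\<^sub>L T) = cw_hol (cw_q P \<nu> u'' - cw_q P \<nu> u) (w' + cw_A \<phi>' w) (cw_A (\<phi>' o\<^sub>L \<phi>))"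
      using hol_compose[of "cw_A \<phi>'", OF cw_A_inner[OF K(2)] bounded_linear.linear[OF bounded_linear_cw_A]]
      by (intro ext) (simp add: u'(4) u''(4) A)
    then show "\<exists>u''\<in>dom (fst d). par (fst d) u'' = c (snd d) \<and>
      (\<exists>w. \<exists>\<phi>\<in>snd ` \<Gamma>. blinfun_apply (T' o\<^sub>L T) = cw_hol (cw_q P \<nu> u'' - cw_q P \<nu> u) w (cw_A \<phi>))"
      using u'' snd_Gamma_compose[OF u''(3) u'(3)] by blast
  qed
qed

end

lemma hol_Blinfun:
  assumes "bounded_linear A"
  shows "blinfun_apply (Blinfun (cw_hol c w A)) = cw_hol c w A"
  by (rule bounded_linear_Blinfun_apply[OF bounded_linear_hol[OF assms]])

text \<open>The form in which freeness and properness reach the construction of loops: every point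
  of \<open>X\<close> lies in the domain of a chart of the quotient.\<close>

locale cw_covering = cw_subgroup +
  assumes charts: "\<exists>U. open U \<and> p \<in> U \<and> inj_on orb U"
begin

lemma chart_at:
  obtains \<kappa> where "\<kappa> \<in> M" "p \<in> dom \<kappa>"
proof -
  obtain U where "open U" "p \<in> U" "inj_on orb U"
    using charts by blast
  then have "\<lparr>dom = U, par = orb, met = cw_metric P \<nu>\<rparr> \<in> M"
    by (simp add: cw_quotient_eq)
  then show ?thesis
    using that \<open>p \<in> U\<close> by fastforce
qed

lemma par_transport_change_id:
  assumes "\<kappa> \<in> M" "\<kappa>' \<in> M" "p \<in> dom \<kappa>" "p \<in> dom \<kappa>'" "orb p = c t"
  shows "par_transport M c (\<kappa>, t) (\<kappa>', t) id_blinfun"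
proof (rule par_transport.change[where u=p])
  have "cw_act P \<nu> \<one>\<^bsub>cw_G P \<nu>\<^esub> = (\<lambda>x. x)"
    using cw_act_one by blast
  then show "((inv_into (dom \<kappa>') (par \<kappa>') \<circ> par \<kappa>) has_derivative blinfun_apply id_blinfun) (at p)"
    using transition_has_derivative[OF Gamma_one, of "dom \<kappa>'" p "\<lambda>x. x"] assms
    by (simp add: cw_quotient_eq id_def)
qed (use assms in \<open>auto simp: cw_quotient_eq\<close>)

text \<open>Since a \<open>piece\<close> must stay in one chart, the curve is subdivided; the
  Bolzano bisection principle replaces an explicit finite partition.\<close>

lemma par_transport_lift:
  assumes C1: "C1_curve_on {0..1} x x'"
    and W: "\<And>r. r \<in> {0..1} \<Longrightarrow>
      (W has_vector_derivative fst (snd (x' r)) *\<^sub>R (cw_sig P \<nu> * snd (snd (x r)))) (at r within {0..1})"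
    and \<kappa>: "\<kappa> \<in> M" "x 0 \<in> dom \<kappa>" and \<kappa>': "\<kappa>' \<in> M" "x 1 \<in> dom \<kappa>'"
  shows "par_transport M (\<lambda>r. orb (x r)) (\<kappa>, 0) (\<kappa>', 1)
    (Blinfun (cw_hol (cw_q P \<nu> (x 1) - cw_q P \<nu> (x 0)) (W 1 - W 0) (\<lambda>x. x)))"
proof -
  let ?T = "\<lambda>a b. Blinfun (cw_hol (cw_q P \<nu> (x b) - cw_q P \<nu> (x a)) (W b - W a) (\<lambda>x. x))"
  let ?c = "\<lambda>r. orb (x r)"
  have T: "blinfun_apply (?T a b) = cw_hol (cw_q P \<nu> (x b) - cw_q P \<nu> (x a)) (W b - W a) (\<lambda>x. x)" for a b
    by (rule hol_Blinfun) (rule bounded_linear_ident)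
  have T_compose: "?T b d o\<^sub>L ?T a b = ?T a d" for a b d
    by (rule blinfun_eqI) (simp add: T hol_compose linear_iff)
  have x: "(x has_vector_derivative x' r) (at r within {0..1})" if "r \<in> {0..1}" for r
    using C1 that by (auto simp: C1_curve_on_def)
  have cont: "continuous_on {0..1} x"
    unfolding continuous_on_eq_continuous_within using x has_vector_derivative_continuous by blast
  \<comment> \<open>Quantifying over all charts at both ends makes the property transitive: any
    chart at the intermediate point will do.\<close>
  define Q where "Q a b \<longleftrightarrow> (0 \<le> a \<longrightarrow> a \<le> b \<longrightarrow> b \<le> 1 \<longrightarrow>
    (\<forall>\<kappa>\<in>M. \<forall>\<kappa>'\<in>M. x a \<in> dom \<kappa> \<longrightarrow> x b \<in> dom \<kappa>' \<longrightarrow> par_transport M ?c (\<kappa>, a) (\<kappa>', b) (?T a b)))" for a b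
  have "Q 0 1"
  proof (rule Bolzano[of 0 1 Q])
    fix a b d assume trans: "Q a b" "Q b d" "a \<le> b" "b \<le> d"
    show "Q a d"
      unfolding Q_def
    proof (intro impI ballI)
      fix \<kappa> \<kappa>' assume *: "0 \<le> a" "a \<le> d" "d \<le> 1" "\<kappa> \<in> M" "\<kappa>' \<in> M" "x a \<in> dom \<kappa>" "x d \<in> dom \<kappa>'"
      obtain \<kappa>'' where "\<kappa>'' \<in> M" "x b \<in> dom \<kappa>''"
        by (rule chart_at)
      then have "par_transport M ?c (\<kappa>, a) (\<kappa>'', b) (?T a b)" "par_transport M ?c (\<kappa>'', b) (\<kappa>', d) (?T b d)"
        using trans * by (auto simp: Q_def)
      from par_transport.concat[OF this] show "par_transport M ?c (\<kappa>, a) (\<kappa>', d) (?T a d)"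
        by (simp only: T_compose)
    qed
  next
    fix r :: real assume local: "0 \<le> r" "r \<le> 1"
    obtain \<kappa>'' where \<kappa>'': "\<kappa>'' \<in> M" "x r \<in> dom \<kappa>''"
      by (rule chart_at)
    then have "open (dom \<kappa>'')"
      by (simp add: cw_quotient_eq)
    then obtain e where "e > 0" and e: "ball (x r) e \<subseteq> dom \<kappa>''"
      using \<kappa>''(2) open_contains_ball by metis
    then obtain \<delta> where "\<delta> > 0" and dist: "\<And>y. y \<in> {0..1} \<Longrightarrow> dist y r < \<delta> \<Longrightarrow> dist (x y) (x r) < e"
      using cont[unfolded continuous_on_iff, rule_format, of r e] local by auto
    have \<delta>: "x y \<in> dom \<kappa>''" if "y \<in> {0..1}" "dist y r < \<delta>" for y
      using dist[OF that] e by (auto simp: dist_commute)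
    have "Q a b" if ab: "a \<le> r" "r \<le> b" "b - a < \<delta>" for a b
      unfolding Q_def
    proof (intro impI ballI)
      fix \<kappa> \<kappa>' assume *: "0 \<le> a" "a \<le> b" "b \<le> 1" "\<kappa> \<in> M" "\<kappa>' \<in> M" "x a \<in> dom \<kappa>" "x b \<in> dom \<kappa>'"
      have sub: "{a..b} \<subseteq> {0..1}"
        using * by auto
      have in_dom: "x s \<in> dom \<kappa>''" if "s \<in> {a..b}" for s
        using \<delta>[of s] that * ab by (auto simp: dist_real_def)
      have x_ab: "(x has_vector_derivative x' s) (at s within {a..b})" if "s \<in> {a..b}" for s
        using has_vector_derivative_within_subset[OF x sub] that sub by blast
      have W_ab: "((\<lambda>s. W s - W a) has_vector_derivative fst (snd (x' s)) *\<^sub>R (cw_sig P \<nu> * snd (snd (x s)))) (at s within {a..b})"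
        if "s \<in> {a..b}" for s
        using has_vector_derivative_diff[OF has_vector_derivative_within_subset[OF W sub] has_vector_derivative_const] that sub
        by auto
      have "par_transport M ?c (\<kappa>'', a) (\<kappa>'', b) (?T a b)"
      proof (rule par_transport.piece[where x=x and x'=x'])
        show "C1_curve_on {a..b} x x'"
          using x_ab C1 continuous_on_subset[OF _ sub] by (auto simp: C1_curve_on_def)
        show "\<forall>v. \<exists>V. parallel_on (met \<kappa>'') {a..b} x x' V \<and> V a = v \<and> V b = ?T a b v"
        proof
          fix v
          show "\<exists>V. parallel_on (met \<kappa>'') {a..b} x x' V \<and> V a = v \<and> V b = ?T a b v"
            using cw_parallel_hol[OF x_ab W_ab, of "cw_q P \<nu> (x a)" v] \<kappa>''(1)
            by (intro exI[of _ "\<lambda>s. cw_hol (cw_q P \<nu> (x s) - cw_q P \<nu> (x a)) (W s - W a) (\<lambda>x. x) v"])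
              (simp add: T cw_quotient_eq)
        qed
      qed (use * \<kappa>'' in_dom in \<open>auto simp: cw_quotient_eq\<close>)
      \<comment> \<open>Both charts contain the same lift, so the group element involved is the
        identity and the change contributes nothing.\<close>
      moreover have "par_transport M ?c (\<kappa>, a) (\<kappa>'', a) id_blinfun" "par_transport M ?c (\<kappa>'', b) (\<kappa>', b) id_blinfun"
        using * \<kappa>'' in_dom par_transport_change_id[where p="x a"] par_transport_change_id[where p="x b"] by auto
      ultimately have "par_transport M ?c (\<kappa>, a) (\<kappa>', b) (id_blinfun o\<^sub>L (?T a b o\<^sub>L id_blinfun))"
        by (blast intro: par_transport.concat)
      then show "par_transport M ?c (\<kappa>, a) (\<kappa>', b) (?T a b)"
        by simp
    qed
    then show "\<exists>\<delta>>0. \<forall>a b. a \<le> r \<and> r \<le> b \<and> b - a < \<delta> \<longrightarrow> Q a b"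
      using \<open>\<delta> > 0\<close> by blast
  qed simp
  then show ?thesis
    using \<kappa> \<kappa>' by (simp add: Q_def)
qed

end

text \<open>Given the endpoints, a cubic perturbation of \<open>x\<^sub>1\<close> and a quadratic perturbation \<open>\<alpha> r (1 - r)\<close>
  of \<open>x\<close> suffice; \<open>k\<close> is chosen so that \<open>\<alpha>\<close> has coefficient 1 in \<open>\<integral> x dx\<^sub>1\<close>.\<close>

lemma cw_curve_exists:
  fixes u u' :: "'n::finite cw_point"
  assumes \<nu>: "\<forall>i. \<nu> $ i \<noteq> 0"
  obtains x x' W where "C1_curve_on {0..1} x x'" "x 0 = u" "x 1 = u'" "W 0 = 0" "W 1 = w"
    "\<And>r. r \<in> {0..1} \<Longrightarrow>
      (W has_vector_derivative fst (snd (x' r)) *\<^sub>R (cw_sig P \<nu> * snd (snd (x r)))) (at r within {0..1})"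
proof -
  obtain u0 u1 a u0' u1' a' where u: "u = (u0, u1, a)" and u': "u' = (u0', u1', a')"
    by (metis surj_pair)
  define \<Delta> where "\<Delta> = u1' - u1"
  \<comment> \<open>The quadratic perturbation contributes \<alpha> with coefficient
    \<open>\<Delta> / 6 - k / 30\<close>. Oscillating \<open>x\<^sub>1\<close> is what keeps this
    nonzero when \<Delta> = 0. The cubic has integral zero over the unit interval, so \<alpha> only
    has to correct for \<open>a \<Delta> + d \<Delta> / 2\<close>.\<close>
  define k where "k = 5 * \<Delta> - 30"
  define d where "d = a' - a"
  define \<alpha> where "\<alpha> = (\<chi> i. w $ i / cw_sig P \<nu> $ i - a $ i * \<Delta> - d $ i * \<Delta> / 2)"
  define X X' where "X r = (\<chi> i. a $ i + r * d $ i + \<alpha> $ i * (r - r^2))" and "X' r = (\<chi> i. d $ i + \<alpha> $ i * (1 - 2 * r))" for r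
  define Z Z' where "Z r = u1 + r * \<Delta> + k * (r - 3 * r^2 + 2 * r^3)" and "Z' r = \<Delta> + k * (1 - 6 * r + 6 * r^2)" for r
  \<comment> \<open>The antiderivative, vanishing at 0, of \<open>Z' r * X r $ i\<close> expanded in
    powers of \<open>r\<close>.\<close>
  define F where "F i r = a $ i * (\<Delta> + k) * r + ((d $ i + \<alpha> $ i) * (\<Delta> + k) - 6 * k * a $ i) * r^2 / 2
    + (6 * k * a $ i - 6 * k * (d $ i + \<alpha> $ i) - \<alpha> $ i * (\<Delta> + k)) * r^3 / 3
    + 6 * k * (d $ i + 2 * \<alpha> $ i) * r^4 / 4 - 6 * k * \<alpha> $ i * r^5 / 5" for i r
  define W where "W r = (\<chi> i. cw_sig P \<nu> $ i * F i r)" for r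
  let ?x = "\<lambda>r. (u0 + r * (u0' - u0), Z r, X r)" and ?x' = "\<lambda>r. (u0' - u0, Z' r, X' r)"
  have X: "(X has_vector_derivative X' r) (at r within S)" for r S
    by (rule has_vector_derivative_vec) (auto simp: X_def X'_def intro!: derivative_eq_intros)
  have Z: "(Z has_vector_derivative Z' r) (at r within S)" for r S
    unfolding Z_def[abs_def] Z'_def has_real_derivative_iff_has_vector_derivative[symmetric]
    by (auto intro!: derivative_eq_intros simp: algebra_simps)
  have "(?x has_vector_derivative ?x' r) (at r within S)" for r S
    by (intro has_vector_derivative_Pair X Z) (auto intro!: derivative_eq_intros simp: has_vector_derivative_def)
  moreover have "continuous_on S ?x'" for S
    unfolding X'_def Z'_def by (intro continuous_intros)
  ultimately have "C1_curve_on {0..1} ?x ?x'"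
    by (simp add: C1_curve_on_def)
  moreover have "?x 0 = u" "?x 1 = u'"
    by (simp_all add: u u' X_def Z_def \<Delta>_def d_def vec_eq_iff)
  moreover have "W 0 = 0"
    by (simp add: W_def F_def vec_eq_iff)
  moreover have "W 1 = w"
  proof -
    have "F i 1 = a $ i * \<Delta> + d $ i * \<Delta> / 2 + \<alpha> $ i" for i
      by (simp add: F_def k_def field_simps)
    then have "F i 1 = w $ i / cw_sig P \<nu> $ i" for i
      by (simp add: \<alpha>_def)
    moreover have "cw_sig P \<nu> $ i \<noteq> 0" for i
      using \<nu> by (simp add: cw_sig_def cw_eps_def)
    ultimately show ?thesis
      by (simp add: W_def vec_eq_iff)
  qed
  moreover have "(W has_vector_derivative fst (snd (?x' r)) *\<^sub>R (cw_sig P \<nu> * snd (snd (?x r)))) (at r within {0..1})" for r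
  proof (rule has_vector_derivative_vec)
    fix i
    have "(F i has_real_derivative Z' r * X r $ i) (at r within {0..1})"
      unfolding F_def[abs_def]
      by (auto intro!: derivative_eq_intros simp: X_def Z'_def) (simp add: algebra_simps power2_eq_square power3_eq_cube power4_eq_xxxx)
    from DERIV_cmult[OF this, of "cw_sig P \<nu> $ i"]
    show "((\<lambda>r. W r $ i) has_real_derivative (fst (snd (?x' r)) *\<^sub>R (cw_sig P \<nu> * snd (snd (?x r)))) $ i) (at r within {0..1})"
      by (simp add: W_def mult_ac)
  qed
  ultimately show ?thesis
    using that by blast
qed

context cw_covering
begin

text \<open>A curve from \<open>u\<close> to its translate under the inverse of \<gamma> projects to
  a loop. Returning to the chart \<kappa> applies the differential of \<gamma>, which contributes
  \<phi>, and the two differences of \<open>cw_q\<close> cancel.\<close>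

lemma hol_in_holonomy:
  assumes \<nu>: "\<forall>i. \<nu> $ i \<noteq> 0" and \<kappa>: "\<kappa> \<in> M" "u \<in> dom \<kappa>" and \<phi>: "\<phi> \<in> snd ` \<Gamma>"
  shows "Blinfun (cw_hol 0 w (cw_A \<phi>)) \<in> carrier (holonomy_group M \<kappa> (orb u))"
proof -
  obtain \<gamma> where \<gamma>: "\<gamma> \<in> \<Gamma>" "\<phi> = snd \<gamma>"
    using \<phi> by blast
  obtain \<gamma>' where \<gamma>': "\<gamma>' \<in> \<Gamma>" "\<gamma> \<otimes>\<^bsub>cw_G P \<nu>\<^esub> \<gamma>' = \<one>\<^bsub>cw_G P \<nu>\<^esub>"
    by (rule Gamma_inverse[OF \<gamma>(1)])
  have K: "\<phi> \<in> carrier (cw_K P \<nu>)" "snd \<gamma>' \<in> carrier (cw_K P \<nu>)"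
    using \<gamma> \<gamma>' snd_Gamma by auto
  have "\<phi> o\<^sub>L snd \<gamma>' = id_blinfun"
    using snd_mult[of \<gamma> \<gamma>'] \<gamma> \<gamma>' by (simp add: cw_G_one)
  then have A_inv: "cw_A \<phi> (cw_A (snd \<gamma>') v) = v" for v
    using cw_A_compose[OF K(2), of \<phi> v] by simp
  define u' where "u' = cw_act P \<nu> \<gamma>' u"
  have u: "cw_act P \<nu> \<gamma> u' = u"
    using \<gamma> \<gamma>' cw_act_mult[OF Gamma_carrier Gamma_carrier, of \<gamma> \<gamma>' u] cw_act_one[of P \<nu> u] by (simp add: u'_def)
  obtain w' where w': "(cw_act P \<nu> \<gamma> has_derivative cw_hol (cw_q P \<nu> u - cw_q P \<nu> u') w' (cw_A \<phi>)) (at u')"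
    using cw_act_has_derivative[OF Gamma_carrier[OF \<gamma>(1)], of u'] u \<gamma>(2) by auto
  obtain \<kappa>' where \<kappa>': "\<kappa>' \<in> M" "u' \<in> dom \<kappa>'"
    by (rule chart_at)
  \<comment> \<open>By the composition rule the loop has null part
    \<open>w' + cw_A \<phi> (W 1)\<close>. Since \<open>cw_A (snd \<gamma>')\<close> inverts
    \<open>cw_A \<phi>\<close>, this value of \<open>W 1\<close> makes it equal to
    \<open>w\<close>.\<close>
  obtain x x' W where x: "C1_curve_on {0..1} x x'" "x 0 = u" "x 1 = u'" "W 0 = 0" "W 1 = cw_A (snd \<gamma>') (w - w')"
    and W: "\<And>r. r \<in> {0..1} \<Longrightarrow>
      (W has_vector_derivative fst (snd (x' r)) *\<^sub>R (cw_sig P \<nu> * snd (snd (x r)))) (at r within {0..1})"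
    using cw_curve_exists[OF \<nu>, of u u' "cw_A (snd \<gamma>') (w - w')" P] by blast
  have orb_u: "orb u' = orb u"
    using \<gamma>(1) u orb_eq_iff by metis
  let ?c = "\<lambda>r. orb (x r)"
  let ?T1 = "Blinfun (cw_hol (cw_q P \<nu> u' - cw_q P \<nu> u) (cw_A (snd \<gamma>') (w - w')) (\<lambda>x. x))"
  let ?T2 = "Blinfun (cw_hol (cw_q P \<nu> u - cw_q P \<nu> u') w' (cw_A \<phi>))"
  have "par_transport M ?c (\<kappa>, 0) (\<kappa>', 1) ?T1"
    using par_transport_lift[OF x(1) W, of \<kappa> \<kappa>'] x \<kappa> \<kappa>' by simp
  moreover have "par_transport M ?c (\<kappa>', 1) (\<kappa>, 1) ?T2"
  proof (rule par_transport.change[where u=u'])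
    show "((inv_into (dom \<kappa>) (par \<kappa>) \<circ> par \<kappa>') has_derivative blinfun_apply ?T2) (at u')"
      using transition_has_derivative[OF \<gamma>(1) _ _ _ w', of "dom \<kappa>"] \<kappa> \<kappa>' u
      by (simp add: cw_quotient_eq hol_Blinfun bounded_linear_cw_A)
  qed (use \<kappa> \<kappa>' x orb_u in \<open>auto simp: cw_quotient_eq\<close>)
  ultimately have "par_transport M ?c (\<kappa>, 0) (\<kappa>, 1) (?T2 o\<^sub>L ?T1)"
    by (rule par_transport.concat)
  moreover have "?T2 o\<^sub>L ?T1 = Blinfun (cw_hol 0 w (cw_A \<phi>))"
    using hol_compose[of "cw_A \<phi>", OF cw_A_inner[OF K(1)] bounded_linear.linear[OF bounded_linear_cw_A]]
    by (intro blinfun_eqI) (simp add: hol_Blinfun bounded_linear_cw_A bounded_linear_ident A_inv)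
  ultimately show ?thesis
    using x orb_u by (auto simp: holonomy_group_def intro!: exI[of _ ?c])
qed

text \<open>For a loop, initial and final lift lie in the same chart over the same orbit, so
  injectivity makes them equal and the scalar vanishes.\<close>

lemma holonomy_carrier:
  assumes \<nu>: "\<forall>i. \<nu> $ i \<noteq> 0" and \<kappa>: "\<kappa> \<in> M" "u \<in> dom \<kappa>"
  shows "carrier (holonomy_group M \<kappa> (orb u)) = {Blinfun (cw_hol 0 w (cw_A \<phi>)) |w \<phi>. \<phi> \<in> snd ` \<Gamma>}"
proof (intro equalityI subsetI)
  fix T assume "T \<in> carrier (holonomy_group M \<kappa> (orb u))"
  then obtain c where c: "c 0 = orb u" "c 1 = orb u" "par_transport M c (\<kappa>, 0) (\<kappa>, 1) T"
    by (auto simp: holonomy_group_def)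
  have par: "inj_on orb (dom \<kappa>)" "par \<kappa> = orb"
    using \<kappa>(1) by (auto simp: cw_quotient_eq)
  obtain u' w \<phi> where u': "u' \<in> dom \<kappa>" "orb u' = orb u" "\<phi> \<in> snd ` \<Gamma>"
    "blinfun_apply T = cw_hol (cw_q P \<nu> u' - cw_q P \<nu> u) w (cw_A \<phi>)"
    using bspec[OF par_transport_hol[OF c(3)], of u] \<kappa>(2) unfolding fst_conv snd_conv par(2) c by blast
  have "u' = u"
    using u' \<kappa> by (intro inj_onD[OF par(1)]) auto
  then have "T = Blinfun (cw_hol 0 w (cw_A \<phi>))"
    using u'(4) by (metis blinfun_apply_inverse diff_self)
  then show "T \<in> {Blinfun (cw_hol 0 w (cw_A \<phi>)) |w \<phi>. \<phi> \<in> snd ` \<Gamma>}"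
    using u'(3) by blast
qed (use hol_in_holonomy[OF assms] in blast)

end

subsection \<open>The holonomy group\<close>

lemma compact_discrete_imp_finite:
  fixes S :: "'a::metric_space set"
  assumes "compact S" "discrete S"
  shows "finite S"
  using assms by (metis compact_eq_Bolzano_Weierstrass discrete_def isolated_in_islimpt_iff subset_refl)

context cw_subgroup
begin

text \<open>Properness makes the preimage of \<open>C \<times> C\<close> compact; its projection to
  \<open>\<Gamma>\<close> is compact and discrete, hence finite.\<close>

lemma finite_returning:
  assumes disc: "discrete \<Gamma>" and proper: "cw_acts_properly P \<nu> \<Gamma>" and C: "compact C"
  shows "finite {\<gamma>\<in>\<Gamma>. \<exists>x\<in>C. cw_act P \<nu> \<gamma> x \<in> C}"
proof -
  let ?X = "prod_topology (top_of_set \<Gamma>) (euclidean :: 'n cw_point topology)"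
  let ?S = "{z. z \<in> topspace ?X \<and> (\<lambda>(\<gamma>, x). (cw_act P \<nu> \<gamma> x, x)) z \<in> C \<times> C}"
  have "compactin (prod_topology euclidean euclidean) (C \<times> C)"
    using C by (simp add: compact_Times euclidean_product_topology)
  then have "compactin ?X ?S"
    using compactin_proper_map_preimage[OF proper[unfolded cw_acts_properly_def]] by blast
  then have "compactin (top_of_set \<Gamma>) (fst ` ?S)"
    by (rule image_compactin) (rule continuous_map_fst)
  then have S: "compact (fst ` ?S)" "fst ` ?S \<subseteq> \<Gamma>"
    by (simp_all add: compactin_subtopology)
  have "finite (fst ` ?S)"
    using S disc by (blast intro: compact_discrete_imp_finite discrete_subset)
  moreover have "{\<gamma>\<in>\<Gamma>. \<exists>x\<in>C. cw_act P \<nu> \<gamma> x \<in> C} \<subseteq> fst ` ?S"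
    by (auto simp: image_iff) blast
  ultimately show ?thesis
    by (rule finite_subset[rotated])
qed

text \<open>Every \<gamma> moves the origin into some closed ball of integer radius, so
  \<open>\<Gamma>\<close> is a countable union of the finite sets of elements returning to such a
  ball.\<close>

lemma countable_Gamma:
  assumes disc: "discrete \<Gamma>" and proper: "cw_acts_properly P \<nu> \<Gamma>"
  shows "countable \<Gamma>"
proof -
  let ?F = "\<lambda>n. {\<gamma>\<in>\<Gamma>. \<exists>x\<in>cball 0 (real n). cw_act P \<nu> \<gamma> x \<in> cball 0 (real n)}"
  have "\<gamma> \<in> (\<Union>n. ?F n)" if "\<gamma> \<in> \<Gamma>" for \<gamma>
  proof -
    obtain n where "norm (cw_act P \<nu> \<gamma> 0) \<le> real n"
      using real_arch_simple by blast
    then show ?thesis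
      using that by (intro UN_I[of n]) (auto intro!: bexI[of _ 0])
  qed
  moreover have "countable (\<Union>n. ?F n)"
    by (rule countable_UN, simp, rule countable_finite, rule finite_returning[OF disc proper compact_cball])
  ultimately show ?thesis
    by (meson countable_subset subsetI)
qed

text \<open>Near \<open>p\<close> only finitely many nontrivial elements can identify points.
  Freeness separates \<open>p\<close> from each of its images under them, and finitely many
  neighbourhoods intersect in an open set.\<close>

lemma covering:
  assumes disc: "discrete \<Gamma>" and free: "cw_acts_freely P \<nu> \<Gamma>" and proper: "cw_acts_properly P \<nu> \<Gamma>"
  shows "cw_covering P \<nu> \<Gamma>"
proof
  fix p
  define F where "F = {\<gamma>\<in>\<Gamma>. \<exists>x\<in>cball p 1. cw_act P \<nu> \<gamma> x \<in> cball p 1} - {\<one>\<^bsub>cw_G P \<nu>\<^esub>}"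
  have "finite F"
    using finite_returning[OF disc proper compact_cball] by (simp add: F_def)
  have "\<exists>V. open V \<and> p \<in> V \<and> (\<forall>x\<in>V. cw_act P \<nu> \<gamma> x \<notin> V)" if "\<gamma> \<in> F" for \<gamma>
  proof -
    have \<gamma>: "\<gamma> \<in> \<Gamma>" "cw_act P \<nu> \<gamma> p \<noteq> p"
      using that free unfolding F_def cw_acts_freely_def by blast+
    then obtain A B where AB: "open A" "open B" "p \<in> A" "cw_act P \<nu> \<gamma> p \<in> B" "A \<inter> B = {}"
      by (metis hausdorff)
    have "open (cw_act P \<nu> \<gamma> -` B)"
      using AB(2) cw_act_continuous[OF Gamma_carrier[OF \<gamma>(1)]] by (rule open_vimage)
    then show ?thesis
      using AB by (intro exI[of _ "A \<inter> cw_act P \<nu> \<gamma> -` B"]) auto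
  qed
  then obtain V where V: "\<And>\<gamma>. \<gamma> \<in> F \<Longrightarrow> open (V \<gamma>) \<and> p \<in> V \<gamma> \<and> (\<forall>x\<in>V \<gamma>. cw_act P \<nu> \<gamma> x \<notin> V \<gamma>)"
    by metis
  let ?U = "ball p 1 \<inter> (\<Inter>\<gamma>\<in>F. V \<gamma>)"
  have "open ?U"
    using \<open>finite F\<close> V by (intro open_Int open_ball open_INT) auto
  moreover have "p \<in> ?U"
    using V by auto
  moreover have "inj_on orb ?U"
  proof (rule inj_onI)
    fix x y assume x: "x \<in> ?U" and y: "y \<in> ?U" and orb: "orb x = orb y"
    then obtain \<gamma> where \<gamma>: "\<gamma> \<in> \<Gamma>" "y = cw_act P \<nu> \<gamma> x"
      using orb_eq_iff[THEN iffD1, OF orb] by blast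
    show "x = y"
    proof (cases "\<gamma> = \<one>\<^bsub>cw_G P \<nu>\<^esub>")
      case True
      then show ?thesis
        using \<gamma>(2) cw_act_one[of P \<nu> x] by simp
    next
      case False
      then have "\<gamma> \<in> F"
        using x y \<gamma> unfolding F_def by (auto intro!: bexI[of _ x])
      then show ?thesis
        using V[of \<gamma>] x y \<gamma>(2) by blast
    qed
  qed
  ultimately show "\<exists>U. open U \<and> p \<in> U \<and> inj_on orb U"
    by blast
qed

lemma snd_Gamma_subgroup: "subgroup (snd ` \<Gamma>) (cw_K P \<nu>)"
proof -
  have "snd \<in> hom (cw_G P \<nu>) (cw_K P \<nu>)"
    by (auto simp: hom_def snd_mult cw_G_carrier simp del: cw_G_mult) (simp add: cw_K_def)
  then interpret group_hom "cw_G P \<nu>" "cw_K P \<nu>" snd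
    by (intro group_hom.intro group_hom_axioms.intro cw_G_group cw_K_group)
  show ?thesis
    by (rule subgroup_img_is_subgroup[OF subgroup])
qed

end

section \<open>The semidirect product with the image of \<open>\<Gamma>\<close> in
  \<open>K\<close>\<close>

lemma cw_Ghat_mult:
  "((z, a), t) \<otimes>\<^bsub>cw_Ghat P \<nu>\<^esub> ((z', a'), t') = ((z + z' + 1/2 * cw_omega P \<nu> a (cw_expL P \<nu> t a'), a + cw_expL P \<nu> t a'), t + t')"
  and cw_Ghat_one: "\<one>\<^bsub>cw_Ghat P \<nu>\<^esub> = ((0, 0), 0)"
  and cw_Ghat_carrier [simp]: "carrier (cw_Ghat P \<nu>) = UNIV"
  by (simp_all add: cw_Ghat_def semidirect_def cw_heisenberg_def)

lemma cw_Ghat_plus_carrier: "carrier (cw_Ghat_plus P \<nu>) = range (\<lambda>b. ((0, cvec b 0), 0))"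
  by (auto simp: cw_Ghat_plus_def cw_aplus_eq)

lemma cw_Ghat_plus_mult:
  "((0, cvec b 0), 0) \<otimes>\<^bsub>cw_Ghat_plus P \<nu>\<^esub> ((0, cvec b' 0), 0) = ((0, cvec (b + b') 0), 0)"
  by (simp add: cw_Ghat_plus_def cw_Ghat_mult cw_omega_cvec cvec_add)

lemma cw_Ghat_plus_one: "\<one>\<^bsub>cw_Ghat_plus P \<nu>\<^esub> = ((0, cvec 0 0), 0)"
  by (simp add: cw_Ghat_plus_def cw_Ghat_one)

lemma cw_Ghat_plus_group: "group (cw_Ghat_plus P \<nu>)"
proof (rule groupI)
  show "\<exists>y\<in>carrier (cw_Ghat_plus P \<nu>). y \<otimes>\<^bsub>cw_Ghat_plus P \<nu>\<^esub> x = \<one>\<^bsub>cw_Ghat_plus P \<nu>\<^esub>"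
    if x: "x \<in> carrier (cw_Ghat_plus P \<nu>)" for x
  proof -
    obtain b where "x = ((0, cvec b 0), 0)"
      using x unfolding cw_Ghat_plus_carrier by blast
    then show ?thesis
      using cw_Ghat_plus_mult[where b="- b" and b'=b]
      by (intro bexI[of _ "((0, cvec (- b) 0), 0)"]) (simp_all add: cw_Ghat_plus_one cw_Ghat_plus_carrier)
  qed
qed (auto simp: cw_Ghat_plus_carrier cw_Ghat_plus_mult cw_Ghat_plus_one simp del: cvec_0)

context cw_subgroup
begin

abbreviation "S \<equiv> cw_Ghat_plus_pK P \<nu> \<Gamma>"

lemma S_carrier: "carrier S = {(((0, cvec b 0), 0), \<phi>) |b \<phi>. \<phi> \<in> snd ` \<Gamma>}"
  by (auto simp: cw_Ghat_plus_pK_def semidirect_def cw_Ghat_plus_carrier)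

lemma S_mult:
  assumes "\<phi> \<in> snd ` \<Gamma>"
  shows "(((0, cvec b 0), 0), \<phi>) \<otimes>\<^bsub>S\<^esub> (((0, cvec b' 0), 0), \<phi>') = (((0, cvec (b + cw_B \<phi> b') 0), 0), \<phi> o\<^sub>L \<phi>')"
proof -
  have "\<phi> \<in> carrier (cw_K P \<nu>)"
    using assms snd_Gamma by auto
  then show ?thesis
    by (simp add: cw_Ghat_plus_pK_def semidirect_def cw_K_act_def cw_K_cvec cw_Ghat_plus_mult) (simp add: cw_K_def)
qed

lemma S_group: "group S"
  unfolding cw_Ghat_plus_pK_def
proof (rule semidirect_group[OF cw_Ghat_plus_group])
  show "group ((cw_K P \<nu>)\<lparr>carrier := snd ` \<Gamma>\<rparr>)"
    by (rule subgroup.subgroup_is_group[OF snd_Gamma_subgroup cw_K_group])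
  show "cw_K_act \<phi> \<in> hom (cw_Ghat_plus P \<nu>) (cw_Ghat_plus P \<nu>)"
    if "\<phi> \<in> carrier ((cw_K P \<nu>)\<lparr>carrier := snd ` \<Gamma>\<rparr>)" for \<phi>
  proof -
    have \<phi>: "\<phi> \<in> carrier (cw_K P \<nu>)"
      using that snd_Gamma by auto
    have "cw_B \<phi> (b + b') = cw_B \<phi> b + cw_B \<phi> b'" for b b'
      by (rule linear_add[OF bounded_linear.linear[OF bounded_linear_cw_B]])
    then show ?thesis
      by (auto simp: hom_def cw_Ghat_plus_carrier cw_Ghat_plus_mult cw_K_act_def cw_K_cvec[OF \<phi>])
  qed
qed (auto simp: cw_K_act_def cw_K_def)

end

text \<open>Hence \<phi> is determined by its orthogonal block, which is all that a holonomy
  transformation shows of it.\<close>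

lemma cw_B_eq:
  assumes "\<forall>i. \<nu> $ i \<noteq> 0" "\<phi> \<in> carrier (cw_K P \<nu>)"
  shows "cw_B \<phi> b = (\<chi> i. inverse (\<nu> $ i)) * cw_A \<phi> (\<nu> * b)"
  unfolding cw_A_B(1)[OF assms(2), symmetric] using assms(1) by (simp add: vec_eq_iff)

section \<open>Comparison of the holonomy group with the semidirect product\<close>

locale cw_holonomy = cw_covering +
  fixes \<kappa> u
  assumes \<nu>: "\<forall>i. \<nu> $ i \<noteq> 0" and \<kappa>: "\<kappa> \<in> M" "u \<in> dom \<kappa>"
begin

abbreviation "Hol \<equiv> holonomy_group M \<kappa> (orb u)"

definition to_Hol :: "'a cw_transvection \<times> 'a cw_end \<Rightarrow> ('a cw_point \<Rightarrow>\<^sub>L 'a cw_point)" where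
  "to_Hol = (\<lambda>(((z, a), t), \<phi>). Blinfun (cw_hol 0 (\<nu> * vRe a) (cw_A \<phi>)))"

text \<open>On vectors \<open>(0, 0, x)\<close> the last component of a holonomy is
  \<open>cw_A \<phi> x\<close>; the other block follows by conjugating with \<open>\<nu>\<close>.
  The formula makes sense for every endomorphism and is continuous in it, as the homeomorphism
  requires.\<close>

definition to_K :: "('a cw_point \<Rightarrow>\<^sub>L 'a cw_point) \<Rightarrow> 'a cw_end" where
  "to_K T = Blinfun (\<lambda>a. cvec ((\<chi> i. inverse (\<nu> $ i)) * snd (snd (T (0, 0, \<nu> * vRe a)))) (snd (snd (T (0, 0, vIm a)))))"

text \<open>The last component of \<open>T (0, 1, 0)\<close> is the vector \<open>w\<close> of the
  null rotation, and dividing by \<open>\<nu>\<close> undoes the scaling in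
  \<open>to_Hol\<close>.\<close>

definition of_Hol :: "('a cw_point \<Rightarrow>\<^sub>L 'a cw_point) \<Rightarrow> 'a cw_transvection \<times> 'a cw_end" where
  "of_Hol T = (((0, cvec ((\<chi> i. inverse (\<nu> $ i)) * snd (snd (T (0, 1, 0)))) 0), 0), to_K T)"

lemma inverse_\<nu> [simp]: "(\<chi> i. inverse (\<nu> $ i)) * (\<nu> * x) = x" "\<nu> * ((\<chi> i. inverse (\<nu> $ i)) * x) = x"
  using \<nu> by (simp_all add: vec_eq_iff)

lemma to_Hol_apply: "blinfun_apply (to_Hol (((z, a), t), \<phi>)) = cw_hol 0 (\<nu> * vRe a) (cw_A \<phi>)"
  by (simp add: to_Hol_def hol_Blinfun bounded_linear_cw_A)

lemma to_K_apply: "blinfun_apply (to_K T) =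
    (\<lambda>a. cvec ((\<chi> i. inverse (\<nu> $ i)) * snd (snd (T (0, 0, \<nu> * vRe a)))) (snd (snd (T (0, 0, vIm a)))))"
proof -
  have inc: "bounded_linear (\<lambda>x. (0::real, 0::real, x::real^'a))"
    by (intro bounded_linear_Pair bounded_linear_zero bounded_linear_ident)
  have T: "bounded_linear (\<lambda>x. snd (snd (T (0, 0, x))))"
    by (intro bounded_linear_compose[OF bounded_linear_snd] bounded_linear_compose[OF blinfun.bounded_linear_right] inc)
  have "bounded_linear (\<lambda>a. cvec ((\<chi> i. inverse (\<nu> $ i)) * snd (snd (T (0, 0, \<nu> * vRe a)))) (snd (snd (T (0, 0, vIm a)))))"
    using bounded_linear_compose[OF bounded_linear_cvec bounded_linear_Pair[OF
      bounded_linear_compose[OF bounded_linear_vec_mult bounded_linear_compose[OF T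
          bounded_linear_compose[OF bounded_linear_vec_mult bounded_linear_vRe]]]
      bounded_linear_compose[OF T bounded_linear_vIm]]]
    by simp
  then show ?thesis
    unfolding to_K_def by (rule bounded_linear_Blinfun_apply)
qed

lemma of_Hol_to_Hol:
  assumes "s \<in> carrier S"
  shows "of_Hol (to_Hol s) = s"
proof -
  obtain b \<phi> where s: "s = (((0, cvec b 0), 0), \<phi>)" and \<phi>: "\<phi> \<in> carrier (cw_K P \<nu>)"
    using assms snd_Gamma by (auto simp: S_carrier)
  have "to_K (to_Hol s) = \<phi>"
  proof (rule blinfun_eqI)
    show "to_K (to_Hol s) a = \<phi> a" for a
      using cw_K_cvec[OF \<phi>, of "vRe a" "vIm a"]
      by (simp add: to_K_apply s to_Hol_apply cw_hol_def cw_B_eq[OF \<nu> \<phi>])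
  qed
  then show ?thesis
    unfolding of_Hol_def by (simp add: s to_Hol_apply cw_hol_def)
qed

lemma to_Hol_image: "to_Hol ` carrier S = carrier Hol"
proof -
  have "Blinfun (cw_hol 0 w (cw_A \<phi>)) \<in> to_Hol ` carrier S" if "\<phi> \<in> snd ` \<Gamma>" for w \<phi>
    using that by (intro image_eqI[of _ _ "(((0, cvec ((\<chi> i. inverse (\<nu> $ i)) * w) 0), 0), \<phi>)"])
      (auto simp: S_carrier to_Hol_def)
  moreover have "to_Hol s \<in> {Blinfun (cw_hol 0 w (cw_A \<phi>)) |w \<phi>. \<phi> \<in> snd ` \<Gamma>}" if "s \<in> carrier S" for s
    using that by (auto simp: S_carrier to_Hol_def)
  ultimately show ?thesis
    unfolding holonomy_carrier[OF \<nu> \<kappa>] by blast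
qed

text \<open>The scaling by \<open>\<nu>\<close> turns the action \<open>cw_B\<close> on translations
  into the action \<open>cw_A\<close> on null rotations, by the first relation in
  \<open>cw_A_B\<close>.\<close>

lemma to_Hol_mult:
  assumes "s \<in> carrier S" "s' \<in> carrier S"
  shows "to_Hol (s \<otimes>\<^bsub>S\<^esub> s') = to_Hol s o\<^sub>L to_Hol s'"
proof -
  obtain b \<phi> b' \<phi>' where s: "s = (((0, cvec b 0), 0), \<phi>)" "\<phi> \<in> snd ` \<Gamma>"
    and s': "s' = (((0, cvec b' 0), 0), \<phi>')" "\<phi>' \<in> snd ` \<Gamma>"
    using assms unfolding S_carrier by blast
  have \<phi>: "\<phi> \<in> carrier (cw_K P \<nu>)" "\<phi>' \<in> carrier (cw_K P \<nu>)"
    using s s' snd_Gamma by auto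
  have A: "cw_A (\<phi> o\<^sub>L \<phi>') = (\<lambda>x. cw_A \<phi> (cw_A \<phi>' x))"
    by (rule ext) (rule cw_A_compose[OF \<phi>(2)])
  show ?thesis
    using hol_compose[of "cw_A \<phi>", OF cw_A_inner[OF \<phi>(1)] bounded_linear.linear[OF bounded_linear_cw_A]]
    by (intro blinfun_eqI)
       (simp add: s(1) s'(1) S_mult[OF s(2)] to_Hol_apply distrib_left cw_A_B[OF \<phi>(1)] A)
qed

lemma Hol_mult: "T \<otimes>\<^bsub>Hol\<^esub> T' = T o\<^sub>L T'"
  by (simp add: holonomy_group_def)

lemma to_Hol_iso: "to_Hol \<in> iso S Hol"
proof -
  have "inj_on to_Hol (carrier S)"
    using of_Hol_to_Hol by (rule inj_on_inverseI)
  then show ?thesis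
    using to_Hol_image to_Hol_mult by (auto simp: iso_def hom_def bij_betw_def holonomy_group_def)
qed

lemma of_Hol_iso: "of_Hol \<in> iso Hol S"
proof -
  have bij: "bij_betw of_Hol (carrier Hol) (carrier S)"
    using of_Hol_to_Hol to_Hol_image
    by (intro bij_betw_byWitness[where f'=to_Hol]) (auto simp flip: to_Hol_image)
  have "of_Hol (T \<otimes>\<^bsub>Hol\<^esub> T') = of_Hol T \<otimes>\<^bsub>S\<^esub> of_Hol T'" if TT': "T \<in> carrier Hol" "T' \<in> carrier Hol" for T T'
  proof -
    obtain s s' where s: "s \<in> carrier S" "T = to_Hol s" "s' \<in> carrier S" "T' = to_Hol s'"
      using TT' to_Hol_image by blast
    have "T \<otimes>\<^bsub>Hol\<^esub> T' = to_Hol (s \<otimes>\<^bsub>S\<^esub> s')"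
      using s to_Hol_mult by (simp add: Hol_mult)
    then show ?thesis
      using s of_Hol_to_Hol monoid.m_closed[OF group.is_monoid[OF S_group]] by simp
  qed
  then show ?thesis
    using bij by (auto simp: iso_def hom_def bij_betw_def)
qed

text \<open>In finite dimension an operator-valued map is continuous once its values on each fixed
  vector are, so both directions reduce to explicit formulas.\<close>

lemma Hol_homeomorphism: "homeomorphism (carrier Hol) (carrier S) of_Hol to_Hol"
proof -
  have cvec: "continuous_on X (\<lambda>x. cvec (f x) (g x))" if "continuous_on X f" "continuous_on X g"
    for X :: "'b::topological_space set" and f g :: "'b \<Rightarrow> real^'a"
    using bounded_linear.continuous_on[OF bounded_linear_cvec continuous_on_Pair[OF that]] by simp
  note lin = bounded_linear.continuous_on[OF bounded_linear_vec_mult]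
    bounded_linear.continuous_on[OF bounded_linear_vRe] bounded_linear.continuous_on[OF bounded_linear_vIm]
  have "continuous_on UNIV to_K"
    by (rule continuous_on_blinfun_componentwise, unfold to_K_apply)
       (intro cvec lin continuous_intros blinfun.continuous_on)
  then have "continuous_on (carrier Hol) of_Hol"
    unfolding of_Hol_def
    by (intro cvec lin continuous_intros blinfun.continuous_on) (rule continuous_on_subset, auto)
  moreover have "continuous_on (carrier S) to_Hol"
  proof (rule continuous_on_blinfun_componentwise)
    fix v :: "'a cw_point"
    obtain v0 v1 x where v: "v = (v0, v1, x)" by (metis surj_pair)
    show "continuous_on (carrier S) (\<lambda>s. to_Hol s v)"
    proof -
      have eq: "to_Hol s v = (let w = \<nu> * vRe (snd (fst (fst s))); A = vIm (snd s (cvec 0 x))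
        in (v0 - A \<bullet> w - 1/2 * (w \<bullet> w) * v1, v1, A + v1 *\<^sub>R w))" for s
        by (cases s rule: prod.exhaust) (auto simp: to_Hol_apply v cw_hol_def cw_A_def Let_def)
      show ?thesis
        unfolding eq Let_def by (intro cvec lin continuous_intros blinfun.continuous_on)
    qed
  qed
  moreover have "to_Hol (of_Hol T) = T" if "T \<in> carrier Hol" for T
    using that of_Hol_to_Hol unfolding to_Hol_image[symmetric] by (metis imageE)
  moreover have "of_Hol ` carrier Hol = carrier S"
    using of_Hol_iso by (simp add: iso_def bij_betw_def)
  ultimately show ?thesis
    using of_Hol_to_Hol to_Hol_image unfolding homeomorphism_def by blast
qed

text \<open>Needed to transfer commutativity along the isomorphism. Closure is read off from the
  semidirect product, which spares reparametrising concatenated loops.\<close>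

lemma Hol_monoid: "monoid Hol"
proof -
  interpret S: group S by (rule S_group)
  show ?thesis
  proof (rule monoidI)
    show "T \<otimes>\<^bsub>Hol\<^esub> T' \<in> carrier Hol" if TT': "T \<in> carrier Hol" "T' \<in> carrier Hol" for T T'
    proof -
      obtain s s' where s: "s \<in> carrier S" "T = to_Hol s" "s' \<in> carrier S" "T' = to_Hol s'"
        using TT' to_Hol_image by blast
      have "T \<otimes>\<^bsub>Hol\<^esub> T' = to_Hol (s \<otimes>\<^bsub>S\<^esub> s')"
        using s to_Hol_mult by (simp add: Hol_mult)
      moreover have "s \<otimes>\<^bsub>S\<^esub> s' \<in> carrier S"
        using s by simp
      ultimately show ?thesis
        using to_Hol_image by (metis imageI)
    qed
    have "(id_blinfun :: 'a cw_point \<Rightarrow>\<^sub>L 'a cw_point) = Blinfun (cw_hol 0 0 (cw_A id_blinfun))"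
    proof (rule blinfun_eqI)
      have A: "cw_A id_blinfun = (\<lambda>x :: real^'a. x)"
        by (rule ext) simp
      show "id_blinfun v = Blinfun (cw_hol 0 0 (cw_A id_blinfun)) v" for v :: "'a cw_point"
        unfolding A hol_Blinfun[OF bounded_linear_ident] by simp
    qed
    moreover have "\<one>\<^bsub>Hol\<^esub> = id_blinfun"
      by (simp add: holonomy_group_def)
    ultimately show "\<one>\<^bsub>Hol\<^esub> \<in> carrier Hol"
      using hol_in_holonomy[OF \<nu> \<kappa> snd_Gamma_id, of 0] by simp
  qed (auto simp: holonomy_group_def blinfun_eqI)
qed

text \<open>A translation by \<open>b\<close> commutes with \<phi> exactly if
  \<open>cw_B \<phi> b = b\<close>. If this holds for all \<open>b\<close>, the relation between the
  blocks makes \<phi> the identity.\<close>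

lemma comm_group_Hol_iff: "comm_group Hol \<longleftrightarrow> \<Gamma> \<subseteq> cw_Ghat_in_G P \<nu>"
proof
  assume "\<Gamma> \<subseteq> cw_Ghat_in_G P \<nu>"
  then have id: "snd ` \<Gamma> \<subseteq> {id_blinfun}"
    by (auto simp: cw_Ghat_in_G_def)
  have "comm_group S"
  proof (rule group.group_comm_groupI[OF S_group])
    fix s s' assume "s \<in> carrier S" "s' \<in> carrier S"
    then obtain b b' where "s = (((0, cvec b 0), 0), id_blinfun)" "s' = (((0, cvec b' 0), 0), id_blinfun)"
      using id unfolding S_carrier by blast
    then show "s \<otimes>\<^bsub>S\<^esub> s' = s' \<otimes>\<^bsub>S\<^esub> s"
      by (simp add: S_mult[OF snd_Gamma_id] add.commute)
  qed
  then show "comm_group Hol"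
    using comm_group.iso_imp_comm_group[OF _ _ Hol_monoid] to_Hol_iso by (auto simp: is_iso_def)
next
  assume "comm_group Hol"
  then interpret Hol: comm_group Hol .
  have "\<phi> = id_blinfun" if \<phi>: "\<phi> \<in> snd ` \<Gamma>" for \<phi>
  proof -
    have K: "\<phi> \<in> carrier (cw_K P \<nu>)"
      using \<phi> snd_Gamma by auto
    have B: "cw_B \<phi> b = b" for b
    proof -
      let ?s = "(((0, cvec b 0), 0), id_blinfun)" and ?s' = "(((0, cvec 0 0), 0), \<phi>)"
      have s: "?s \<in> carrier S" "?s' \<in> carrier S"
        unfolding S_carrier using \<phi> snd_Gamma_id by blast+
      note h = imageI[OF s(1), of to_Hol, unfolded to_Hol_image] imageI[OF s(2), of to_Hol, unfolded to_Hol_image]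
      have "to_Hol ?s o\<^sub>L to_Hol ?s' = to_Hol ?s' o\<^sub>L to_Hol ?s"
        using Hol.m_comm[OF h] unfolding Hol_mult .
      then have "of_Hol (to_Hol (?s \<otimes>\<^bsub>S\<^esub> ?s')) = of_Hol (to_Hol (?s' \<otimes>\<^bsub>S\<^esub> ?s))"
        unfolding to_Hol_mult[OF s] to_Hol_mult[OF s(2,1)] by (rule arg_cong)
      then have "?s \<otimes>\<^bsub>S\<^esub> ?s' = ?s' \<otimes>\<^bsub>S\<^esub> ?s"
        using of_Hol_to_Hol s monoid.m_closed[OF group.is_monoid[OF S_group]] by simp
      then show ?thesis
        unfolding S_mult[OF snd_Gamma_id] S_mult[OF \<phi>] by simp
    qed
    \<comment> \<open>Every \<open>x\<close> is \<open>\<nu>\<close> times some vector, because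
      \<open>\<nu>\<close> has no zero component.\<close>
    have A: "cw_A \<phi> x = x" for x
      using cw_A_B(1)[OF K, of "(\<chi> i. inverse (\<nu> $ i)) * x"] by (simp add: B)
    show ?thesis
    proof (rule blinfun_eqI)
      fix a
      show "\<phi> a = id_blinfun a"
        using cw_K_cvec[OF K, of "vRe a" "vIm a"] by (simp add: A B)
    qed
  qed
  then show "\<Gamma> \<subseteq> cw_Ghat_in_G P \<nu>"
    by (force simp: cw_Ghat_in_G_def)
qed

text \<open>The projection to \<open>K\<close> has a connected countable image, whereas a connected
  metric space with two distinct points is uncountable.\<close>

lemma connected_S_imp:
  assumes "countable \<Gamma>" "connected (carrier S)"
  shows "\<Gamma> \<subseteq> cw_Ghat_in_G P \<nu>"
proof -
  have "snd ` carrier S = snd ` \<Gamma>"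
    by (force simp: S_carrier)
  then have "connected (snd ` \<Gamma>)"
    using connected_continuous_image[OF continuous_on_snd[OF continuous_on_id] assms(2)] by simp
  then have "\<phi> = id_blinfun" if "\<phi> \<in> snd ` \<Gamma>" for \<phi>
    using connected_uncountable[of "snd ` \<Gamma>", OF _ that snd_Gamma_id] assms(1) by blast
  then show ?thesis
    by (force simp: cw_Ghat_in_G_def)
qed

lemma path_connected_S:
  assumes "\<Gamma> \<subseteq> cw_Ghat_in_G P \<nu>"
  shows "path_connected (carrier S)"
proof -
  have "snd ` \<Gamma> = {id_blinfun}"
    using assms snd_Gamma_id by (auto simp: cw_Ghat_in_G_def)
  then have "carrier S = range (\<lambda>b. (((0, cvec b 0), 0), id_blinfun))"
    unfolding S_carrier by auto
  moreover have "path_connected (range (\<lambda>b::real^'a. (((0::real, cvec b 0), 0::real), id_blinfun :: 'a cw_end)))"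
    by (intro path_connected_continuous_image continuous_intros path_connected_UNIV
        bounded_linear.continuous_on[OF bounded_linear_cvec_0(2)])
  ultimately show ?thesis
    by simp
qed

end

text \<open>The linear representation of the holonomy depends on the chart at \<open>y\<close>, so
  the conclusion is stated for every chart there, together with the existence of one. The
  homeomorphism makes the isomorphism one of topological groups, with the operator norm topology on
  the holonomy.\<close>

theorem proposition8p4:
  fixes P :: "'n::finite set" and \<nu> :: "real^'n"
    and \<Gamma> :: "('n cw_transvection \<times> 'n cw_end) set"
    and y :: "'n cw_point set"
  assumes "\<forall>i. \<nu> $ i \<noteq> 0"
    and "subgroup \<Gamma> (cw_G P \<nu>)"
    and "discrete \<Gamma>"
    and "cw_acts_freely P \<nu> \<Gamma>"
    and "cw_acts_properly P \<nu> \<Gamma>"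
    and "y \<in> range (cw_orbit P \<nu> \<Gamma>)"
  shows "(\<exists>\<kappa> \<in> cw_quotient P \<nu> \<Gamma>. y \<in> par \<kappa> ` dom \<kappa>) \<and>
    (\<forall>\<kappa> \<in> cw_quotient P \<nu> \<Gamma>. y \<in> par \<kappa> ` dom \<kappa> \<longrightarrow>
      (let Hol = holonomy_group (cw_quotient P \<nu> \<Gamma>) \<kappa> y;
           S = cw_Ghat_plus_pK P \<nu> \<Gamma>
       in (\<exists>f f'. f \<in> iso Hol S \<and> homeomorphism (carrier Hol) (carrier S) f f') \<and>
          (connected (carrier Hol) \<longleftrightarrow> comm_group Hol) \<and>
          (path_connected (carrier Hol) \<longleftrightarrow> comm_group Hol) \<and>
          (comm_group Hol \<longleftrightarrow> \<Gamma> \<subseteq> cw_Ghat_in_G P \<nu>)))"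
proof -
  interpret cw_subgroup P \<nu> \<Gamma>
    by (rule cw_subgroup.intro) fact
  interpret cw_covering P \<nu> \<Gamma>
    by (rule covering) fact+
  have countable: "countable \<Gamma>"
    by (rule countable_Gamma) fact+
  obtain p where p: "y = orb p"
    using assms(6) by blast
  obtain \<kappa> where "\<kappa> \<in> M" "p \<in> dom \<kappa>"
    by (rule chart_at)
  then have "\<exists>\<kappa>\<in>M. y \<in> par \<kappa> ` dom \<kappa>"
    by (auto simp: cw_quotient_eq p)
  moreover have "(\<exists>f f'. f \<in> iso (holonomy_group M \<kappa> y) S
        \<and> homeomorphism (carrier (holonomy_group M \<kappa> y)) (carrier S) f f') \<and>
      (connected (carrier (holonomy_group M \<kappa> y)) \<longleftrightarrow> comm_group (holonomy_group M \<kappa> y)) \<and>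
      (path_connected (carrier (holonomy_group M \<kappa> y)) \<longleftrightarrow> comm_group (holonomy_group M \<kappa> y)) \<and>
      (comm_group (holonomy_group M \<kappa> y) \<longleftrightarrow> \<Gamma> \<subseteq> cw_Ghat_in_G P \<nu>)"
    if \<kappa>: "\<kappa> \<in> M" "y \<in> par \<kappa> ` dom \<kappa>" for \<kappa>
  proof -
    obtain u where u: "u \<in> dom \<kappa>" "y = orb u"
      using \<kappa> by (auto simp: cw_quotient_eq)
    interpret cw_holonomy P \<nu> \<Gamma> \<kappa> u
      by (intro cw_holonomy.intro cw_holonomy_axioms.intro cw_covering_axioms) (fact assms \<kappa> u)+
    have homeo: "carrier Hol homeomorphic carrier S"
      using Hol_homeomorphism homeomorphic_def by blast
    \<comment> \<open>One cycle settles both notions: connected implies that \<open>\<Gamma>\<close>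
      consists of transvections, which implies path connected, which implies connected.\<close>
    have "connected (carrier Hol) \<longleftrightarrow> \<Gamma> \<subseteq> cw_Ghat_in_G P \<nu>"
      using homeomorphic_connectedness[OF homeo] connected_S_imp[OF countable] path_connected_S
        path_connected_imp_connected by blast
    moreover have "path_connected (carrier Hol) \<longleftrightarrow> \<Gamma> \<subseteq> cw_Ghat_in_G P \<nu>"
      using homeomorphic_path_connectedness[OF homeo] connected_S_imp[OF countable] path_connected_S
        path_connected_imp_connected by blast
    ultimately show ?thesis
      using of_Hol_iso Hol_homeomorphism comm_group_Hol_iff unfolding u(2) by blast
  qed
  ultimately show ?thesis
    unfolding Let_def by blast
qed

end
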